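(* Let a sequence of sparse vectors $\{\mathbf{x}^{(M)}\in\mathbb{C}^M\}_M$ with $\|\mathbf{x}^{(M)}\|_0=L=\lfloor\frac1\beta M\rfloor$, where $\beta>2$, be given such that $L\mu^2(\mathbf{x}^{(M)})$ and $P$ are constant. Then asymptotic reliable recovery is possible for $\{\mathbf{x}^{(M)}\}$ with respect to Error Metric 2 if $N\succ C_3 L$, for some constant $C_3>1$ that depends only on $\alpha$, $\beta$, $\mu(\mathbf{x}^{(M)})$ and $\nu$.
   Context: Model: $\mathbf{x}=\mathbf{x}^{(M)}\in\mathbb{C}^M$ is an unknown vector with support $\mathcal{I}=\{i: x_i\ne0\}$, $\|\mathbf{x}\|_0=|\mathcal{I}|=L$, $\mu(\mathbf{x})=\min_{i\in\mathcal{I}}|x_i|$, and total power $P=\|\mathbf{x}\|_2^2$. One observes $\mathbf{y}=\mathbf{A}\mathbf{x}+\mathbf{n}\in\mathbb{C}^N$, where $N$ is a function of $M$, $\mathbf{A}$ is an $N\times M$ Gaussian measurement matrix (i.i.d. circularly symmetric complex Gaussian entries $a_{i,j}\sim\mathcal{N}_C(0,1)$), and $\mathbf{n}\sim\mathcal{N}_C(0,\nu^2I_N)$ is circularly symmetric complex Gaussian noise independent of $\mathbf{A}$. Decoder: a sparse recovery algorithm, knowing $\mathbf{A}$ and observing $\mathbf{y}$, outputs an estimate $\hat{\mathbf{x}}$ with $\|\hat{\mathbf{x}}\|_0=L$; a decoder $\mathcal{D}$ outputs the corresponding set of indices $\mathcal{D}(\mathbf{y})=\{i:\hat x_i\ne0\}$.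 Error Metric 2 (with parameter $\alpha\in(0,1)$): recovery is successful iff $\frac{|\{i:\hat x_i\ne0\}\cap\mathcal{I}|}{|\mathcal{I}|}>1-\alpha$; otherwise an error occurs. For fixed $\mathbf{A}$, $p_{\rm err}(\mathbf{A}|\mathbf{x}^{(M)})$ is the probability of error, and $p_{\rm err}(\mathcal{D}|\mathbf{x}^{(M)})=\mathbb{E}_{\mathbf{A}}\big(p_{\rm err}(\mathbf{A}|\mathbf{x}^{(M)})\big)$ is its average over Gaussian measurement matrices. A decoder achieves asymptotic reliable recovery if $p_{\rm err}(\mathcal{D}|\mathbf{x}^{(M)})\to0$ as $M\to\infty$; recovery is possible if some decoder achieves this. Notation: $f\succ g$ means that either $f=g=0$, or $f,g$ are non-decreasing non-negative functions and there is $x_0$ such that $f(x)/g(x)>1$ for all $x>x_0$ (here as functions of $M$). *)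

theory Defs
  imports "HOL-Probability.Probability"
begin

text \<open>
  The dimensions $M$ and $N = N(M)$ vary along a sequence, so a vector in $C^d$ is a function on
  \<open>nat\<close> of which only the indices below \<open>d\<close> matter, and an $N \times M$ matrix is a function on pairs
  in \<open>{..<N} \<times> {..<M}\<close>.
\<close>

definition support :: "nat \<Rightarrow> (nat \<Rightarrow> complex) \<Rightarrow> nat set" where
  "support M x = {i. i < M \<and> x i \<noteq> 0}"

definition min_abs :: "nat \<Rightarrow> (nat \<Rightarrow> complex) \<Rightarrow> real" where
  "min_abs M x = Min ((\<lambda>i. cmod (x i)) ` support M x)"

definition total_power :: "nat \<Rightarrow> (nat \<Rightarrow> complex) \<Rightarrow> real" where
  "total_power M x = (\<Sum>i<M. (cmod (x i))\<^sup>2)"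

definition sparsity :: "real \<Rightarrow> nat \<Rightarrow> nat" where
  "sparsity \<beta> M = nat \<lfloor>1 / \<beta> * real M\<rfloor>"


text \<open>
  The circularly symmetric law $N_C(0, v)$: independent real and imaginary parts of variance $v / 2$
  each (\<open>normal_density\<close> takes the standard deviation).
\<close>

definition complex_normal :: "real \<Rightarrow> complex measure" where
  "complex_normal v =
     (let R = density lborel (\<lambda>t. ennreal (normal_density 0 (sqrt (v / 2)) t))
      in distr (R \<Otimes>\<^sub>M R) borel (\<lambda>(a, b). Complex a b))"

definition gaussian_matrix :: "nat \<Rightarrow> nat \<Rightarrow> (nat \<times> nat \<Rightarrow> complex) measure" where
  "gaussian_matrix N M = PiM ({..<N} \<times> {..<M}) (\<lambda>_. complex_normal 1)"

definition gaussian_noise :: "real \<Rightarrow> nat \<Rightarrow> (nat \<Rightarrow> complex) measure" where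
  "gaussian_noise \<nu> N = PiM {..<N} (\<lambda>_. complex_normal (\<nu>\<^sup>2))"

definition observation ::
  "nat \<Rightarrow> nat \<Rightarrow> (nat \<times> nat \<Rightarrow> complex) \<Rightarrow> (nat \<Rightarrow> complex) \<Rightarrow> (nat \<Rightarrow> complex) \<Rightarrow> (nat \<Rightarrow> complex)" where
  "observation N M A x n = (\<lambda>i\<in>{..<N}. (\<Sum>j<M. A (i, j) * x j) + n i)"


text \<open>
  An algorithm for dimensions $N \times M$ maps \<open>A\<close> and \<open>y\<close> to an estimate with exactly \<open>L\<close> nonzero
  entries. Measurability cannot be dropped: \<open>measure\<close> and the Bochner integral are $0$ on
  non-measurable arguments, so the error probability of a non-measurable map could vanish spuriously.
\<close>

type_synonym algorithm = "(nat \<times> nat \<Rightarrow> complex) \<Rightarrow> (nat \<Rightarrow> complex) \<Rightarrow> (nat \<Rightarrow> complex)"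

definition sparse_recovery_algorithm :: "nat \<Rightarrow> nat \<Rightarrow> nat \<Rightarrow> algorithm \<Rightarrow> bool" where
  "sparse_recovery_algorithm N M L est \<longleftrightarrow>
     (\<lambda>(A, y). est A y) \<in>
        measurable (PiM ({..<N} \<times> {..<M}) (\<lambda>_. borel) \<Otimes>\<^sub>M PiM {..<N} (\<lambda>_. borel))
                   (PiM {..<M} (\<lambda>_. borel)) \<and>
     (\<forall>A y. card (support M (est A y)) = L)"

definition decoder :: "nat \<Rightarrow> algorithm \<Rightarrow> (nat \<times> nat \<Rightarrow> complex) \<Rightarrow> (nat \<Rightarrow> complex) \<Rightarrow> nat set" where
  "decoder M est A y = support M (est A y)"

definition success2 :: "real \<Rightarrow> nat set \<Rightarrow> nat set \<Rightarrow> bool" where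
  "success2 \<alpha> J I \<longleftrightarrow> real (card (J \<inter> I)) / real (card I) > 1 - \<alpha>"

definition p_err_fixed ::
  "real \<Rightarrow> real \<Rightarrow> nat \<Rightarrow> nat \<Rightarrow> algorithm \<Rightarrow> (nat \<Rightarrow> complex) \<Rightarrow> (nat \<times> nat \<Rightarrow> complex) \<Rightarrow> real" where
  "p_err_fixed \<alpha> \<nu> N M est x A =
     measure (gaussian_noise \<nu> N)
       {n \<in> space (gaussian_noise \<nu> N).
          \<not> success2 \<alpha> (decoder M est A (observation N M A x n)) (support M x)}"

definition p_err ::
  "real \<Rightarrow> real \<Rightarrow> nat \<Rightarrow> nat \<Rightarrow> algorithm \<Rightarrow> (nat \<Rightarrow> complex) \<Rightarrow> real" where
  "p_err \<alpha> \<nu> N M est x = (\<integral>A. p_err_fixed \<alpha> \<nu> N M est x A \<partial>gaussian_matrix N M)"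

definition asymptotic_reliable_recovery ::
  "real \<Rightarrow> real \<Rightarrow> (nat \<Rightarrow> nat) \<Rightarrow> (nat \<Rightarrow> algorithm) \<Rightarrow> (nat \<Rightarrow> nat \<Rightarrow> complex) \<Rightarrow> bool" where
  "asymptotic_reliable_recovery \<alpha> \<nu> N est x \<longleftrightarrow>
     (\<lambda>M. p_err \<alpha> \<nu> (N M) M (est M) (x M)) \<longlonglongrightarrow> 0"


text \<open>
  The signal sequences with $L = \lfloor M / \beta \rfloor$, $L \mu^2 = \kappa$ and constant power. For the
  finitely many $M$ with $L = 0$ the signal is zero and $\mu$ is a minimum over the empty set, so the
  two constancy conditions are imposed where $L \geq 1$.
\<close>

definition signal_sequences :: "real \<Rightarrow> real \<Rightarrow> (nat \<Rightarrow> nat \<Rightarrow> complex) set" where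
  "signal_sequences \<beta> \<kappa> =
     {x. (\<forall>M. card (support M (x M)) = sparsity \<beta> M) \<and>
         (\<forall>M. sparsity \<beta> M \<ge> 1 \<longrightarrow> real (sparsity \<beta> M) * (min_abs M (x M))\<^sup>2 = \<kappa>) \<and>
         (\<exists>P. \<forall>M. sparsity \<beta> M \<ge> 1 \<longrightarrow> total_power M (x M) = P)}"

definition dominates :: "(nat \<Rightarrow> real) \<Rightarrow> (nat \<Rightarrow> real) \<Rightarrow> bool"  (infix "\<succ>" 50) where
  "f \<succ> g \<longleftrightarrow>
     (\<forall>m. f m = 0 \<and> g m = 0) \<or>
     (mono f \<and> mono g \<and> (\<forall>m. 0 \<le> f m) \<and> (\<forall>m. 0 \<le> g m) \<and> (\<exists>m0. \<forall>m>m0. f m / g m > 1))"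

text \<open>
  Recovery is possible for a class of signal sequences when one family of algorithms recovers every
  member. The family comes before the sequence because an algorithm sees only \<open>A\<close> and \<open>y\<close>; chosen after
  the sequence, it could just return the known support.
\<close>

definition recovery_possible ::
  "real \<Rightarrow> real \<Rightarrow> (nat \<Rightarrow> nat) \<Rightarrow> (nat \<Rightarrow> nat) \<Rightarrow> (nat \<Rightarrow> nat \<Rightarrow> complex) set \<Rightarrow> bool" where
  "recovery_possible \<alpha> \<nu> N L X \<longleftrightarrow>
     (\<exists>est. (\<forall>M. sparse_recovery_algorithm (N M) M (L M) (est M)) \<and>
            (\<forall>x\<in>X. asymptotic_reliable_recovery \<alpha> \<nu> N est x))"

end

theory Submission
  imports Defs "HOL-Real_Asymp.Real_Asymp"
begin

text \<open>
  The decoder searches all \<open>L\<close>-element supports \<open>J\<close> for one whose column span comes closer to \<open>y\<close>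
  than a threshold \<open>t\<close>, with \<open>t / N\<close> halfway between the noise power \<open>\<nu>\<^sup>2\<close> and \<open>\<nu>\<^sup>2 + \<alpha> \<kappa>\<close>. The true
  support passes unless the noise energy is exceptionally large. A support with too small overlap misses
  signal energy at least \<open>\<alpha> L \<mu>\<^sup>2 = \<alpha> \<kappa>\<close>, which for fixed columns in \<open>J\<close> acts as additional Gaussian
  noise, so its squared residual is a sum of \<open>N - L\<close> independent exponentials of mean at least
  \<open>\<nu>\<^sup>2 + \<alpha> \<kappa>\<close>. Both events have probability exponentially small in \<open>N\<close>, and a large \<open>N / L\<close> beats
  the at most \<open>2\<^sup>M\<close> candidates of the union bound, where \<open>M \<le> \<beta> (L + 1)\<close>.

  Rotation invariance of the Gaussian law is avoided in the Laplace transform of the residual: the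
  projected energy is linearised by \<open>exp (\<bar>a\<bar>\<^sup>2) = E (exp (2 Re (a w\<^sup>*)))\<close> with \<open>w\<close> standard
  complex normal (Hubbard-Stratonovich), after which all integrals factor over the coordinates.
\<close>

section \<open>Gaussian integrals\<close>

text \<open>Completing the square: the weight turns the centred density into \<open>C\<close> times
  a normal density of mean \<open>m\<close> and variance \<open>v / (2 * q)\<close>, so the integral
  is \<open>C\<close>. Negative \<open>p\<close> is allowed because exponential moments of energies
  are needed later.\<close>

lemma nn_integral_normal_quadratic:
  fixes p d v :: real
  assumes v: "v > 0" and pv: "1 + p * v > 0"
  shows "(\<integral>\<^sup>+a. ennreal (exp (- p * a\<^sup>2 + 2 * d * a))
            \<partial>density lborel (\<lambda>t. ennreal (normal_density 0 (sqrt (v / 2)) t)))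
         = ennreal (exp (v * d\<^sup>2 / (1 + p * v)) / sqrt (1 + p * v))"
proof -
  define q where "q = 1 + p * v"
  define m where "m = d * v / q"
  define C where "C = exp (v * d\<^sup>2 / q) / sqrt q"
  have q: "q > 0" and p: "p = (q - 1) / v" using pv v by (auto simp: q_def)
  have expo: "- a\<^sup>2 / v + (- p * a\<^sup>2 + 2 * d * a) = v * d\<^sup>2 / q + - (a - m)\<^sup>2 / (v / q)" for a
    unfolding m_def p using v q by (simp add: field_simps power2_eq_square)
  have eq: "normal_density 0 (sqrt (v / 2)) a * exp (- p * a\<^sup>2 + 2 * d * a)
      = C * normal_density m (sqrt (v / (2 * q))) a" for a
  proof -
    have "normal_density 0 (sqrt (v / 2)) a * exp (- p * a\<^sup>2 + 2 * d * a)
       = 1 / sqrt (pi * v) * exp (- a\<^sup>2 / v + (- p * a\<^sup>2 + 2 * d * a))"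
      using v by (simp add: normal_density_def mult_exp_exp)
    also have "\<dots> = 1 / sqrt (pi * v) * (exp (v * d\<^sup>2 / q) * exp (- (a - m)\<^sup>2 / (v / q)))"
      by (simp only: expo exp_add)
    also have "\<dots> = C * normal_density m (sqrt (v / (2 * q))) a"
      using v q by (simp add: normal_density_def C_def real_sqrt_divide real_sqrt_mult field_simps)
    finally show ?thesis .
  qed
  have C: "C \<ge> 0" using q by (simp add: C_def)
  have sd: "sqrt (v / (2 * q)) > 0" using v q by simp
  have "(\<integral>\<^sup>+a. ennreal (exp (- p * a\<^sup>2 + 2 * d * a))
            \<partial>density lborel (\<lambda>t. ennreal (normal_density 0 (sqrt (v / 2)) t)))
      = (\<integral>\<^sup>+a. ennreal (normal_density 0 (sqrt (v / 2)) a) * ennreal (exp (- p * a\<^sup>2 + 2 * d * a)) \<partial>lborel)"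
    by (subst nn_integral_density) auto
  also have "\<dots> = (\<integral>\<^sup>+a. ennreal C * ennreal (normal_density m (sqrt (v / (2 * q))) a) \<partial>lborel)"
    using eq by (intro nn_integral_cong) (simp add: C normal_density_nonneg flip: ennreal_mult)
  also have "\<dots> = ennreal C * (\<integral>\<^sup>+a. ennreal (normal_density m (sqrt (v / (2 * q))) a) \<partial>lborel)"
    by (subst nn_integral_cmult) auto
  also have "(\<integral>\<^sup>+a. ennreal (normal_density m (sqrt (v / (2 * q))) a) \<partial>lborel) = 1"
    using sd by (subst nn_integral_eq_integral)
      (auto simp: integral_normal_density integrable_normal_density normal_density_nonneg)
  finally show ?thesis by (simp add: C_def q_def)
qed

section \<open>The complex normal law and its action on quadratic exponentials\<close>

lemma sets_complex_normal [measurable_cong, simp]: "sets (complex_normal v) = sets borel"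
  by (simp add: complex_normal_def Let_def)

lemma space_complex_normal [simp]: "space (complex_normal v) = UNIV"
  by (simp add: complex_normal_def Let_def)

text \<open>The exponent splits into a part in \<open>Re a\<close> and a part in
  \<open>Im a\<close>, which are independent; the two factors \<open>1 / sqrt (1 + p * v)\<close>
  multiply to \<open>1 / (1 + p * v)\<close>.\<close>

lemma nn_integral_complex_normal:
  fixes p v :: real and d :: complex
  assumes v: "v > 0" and pv: "1 + p * v > 0"
  shows "(\<integral>\<^sup>+a. ennreal (exp (- p * (cmod a)\<^sup>2 + 2 * Re (a * cnj d))) \<partial>complex_normal v)
         = ennreal (exp (v * (cmod d)\<^sup>2 / (1 + p * v)) / (1 + p * v))"
proof -
  define R where "R = density lborel (\<lambda>t. ennreal (normal_density 0 (sqrt (v / 2)) t))"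
  have sR [measurable_cong]: "sets R = sets borel" by (simp add: R_def)
  interpret R: prob_space R
    unfolding R_def using v by (intro prob_space_normal_density) simp
  interpret RR: pair_sigma_finite R R ..
  have cm: "(\<lambda>(a, b). Complex a b) \<in> borel_measurable (R \<Otimes>\<^sub>M R)"
  proof -
    have "(\<lambda>(a, b). Complex a b) = (\<lambda>p. of_real (fst p) + \<i> * of_real (snd p))"
      by (auto simp: complex_eq_iff)
    then show ?thesis by simp
  qed
  let ?f = "\<lambda>e a. ennreal (exp (- p * a\<^sup>2 + 2 * e * a))"
  have "(\<integral>\<^sup>+a. ennreal (exp (- p * (cmod a)\<^sup>2 + 2 * Re (a * cnj d))) \<partial>complex_normal v)
     = (\<integral>\<^sup>+z. ennreal (exp (- p * (cmod (case z of (a, b) \<Rightarrow> Complex a b))\<^sup>2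
            + 2 * Re ((case z of (a, b) \<Rightarrow> Complex a b) * cnj d))) \<partial>(R \<Otimes>\<^sub>M R))"
    unfolding complex_normal_def Let_def R_def[symmetric]
    by (subst nn_integral_distr[OF cm]) auto
  also have "\<dots> = (\<integral>\<^sup>+z. ?f (Re d) (fst z) * ?f (Im d) (snd z) \<partial>(R \<Otimes>\<^sub>M R))"
    by (intro nn_integral_cong)
       (auto simp: cmod_power2 algebra_simps split: prod.splits simp flip: ennreal_mult exp_add)
  also have "\<dots> = (\<integral>\<^sup>+a. \<integral>\<^sup>+b. ?f (Re d) a * ?f (Im d) b \<partial>R \<partial>R)"
    by (subst R.nn_integral_fst[symmetric]) auto
  also have "\<dots> = (\<integral>\<^sup>+a. ?f (Re d) a \<partial>R) * (\<integral>\<^sup>+b. ?f (Im d) b \<partial>R)"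
    by (simp add: nn_integral_cmult nn_integral_multc)
  also have "\<dots> = ennreal (exp (v * (Re d)\<^sup>2 / (1 + p * v)) / sqrt (1 + p * v)
                        * (exp (v * (Im d)\<^sup>2 / (1 + p * v)) / sqrt (1 + p * v)))"
    unfolding R_def using v pv by (subst (1 2) nn_integral_normal_quadratic) (auto simp flip: ennreal_mult)
  also have "exp (v * (Re d)\<^sup>2 / (1 + p * v)) / sqrt (1 + p * v)
                        * (exp (v * (Im d)\<^sup>2 / (1 + p * v)) / sqrt (1 + p * v))
      = exp (v * (cmod d)\<^sup>2 / (1 + p * v)) / (1 + p * v)"
    using pv by (simp add: cmod_power2 distrib_left add_divide_distrib flip: exp_add)
  finally show ?thesis .
qed

lemma prob_space_complex_normal:
  assumes "v > 0" shows "prob_space (complex_normal v)"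
proof
  show "emeasure (complex_normal v) (space (complex_normal v)) = 1"
    using nn_integral_complex_normal[of v 0 0] assms by simp
qed

text \<open>The exponent that linearisation leaves in a single coordinate: \<open>h\<close> is the
  coordinate of the vector being projected, \<open>c\<close> that of a combination of the projection
  directions with auxiliary Gaussian weights.\<close>

definition quad_expo :: "real \<Rightarrow> complex \<Rightarrow> complex \<Rightarrow> real" where
  "quad_expo s c h = - s * (cmod h)\<^sup>2 + 2 * Re (h * cnj c)"

text \<open>The mean of \<open>exp (quad_expo s c (h + Z))\<close> for \<open>Z\<close> with law \<open>complex_normal \<tau>\<close>.\<close>

definition smoothed_quad :: "real \<Rightarrow> real \<Rightarrow> complex \<Rightarrow> complex \<Rightarrow> real" where
  "smoothed_quad \<tau> s c h =
     exp ((quad_expo s c h + \<tau> * (cmod c)\<^sup>2) / (1 + s * \<tau>)) / (1 + s * \<tau>)"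

text \<open>Expanding about \<open>h\<close> leaves an exponent in \<open>a\<close> of exactly the
  shape integrated by \<open>nn_integral_complex_normal\<close>.\<close>

lemma quad_expo_shift:
  "quad_expo s c (h + w * a) =
     quad_expo s c h + (- (s * (cmod w)\<^sup>2) * (cmod a)\<^sup>2 + 2 * Re (a * cnj (cnj w * (c - of_real s * h))))"
  unfolding quad_expo_def cmod_power2 by (simp add: power2_eq_square algebra_simps)

text \<open>Variances of independent centred complex normals add, and \<open>w * a\<close> has
  variance v |w|^2. Repeated use integrates out one Gaussian variable after another while the
  integrand keeps its form.\<close>

lemma smoothed_quad_step:
  assumes v: "v > 0" and \<tau>: "0 \<le> \<tau>" and s: "0 \<le> s"
  shows "(\<integral>\<^sup>+a. ennreal (smoothed_quad \<tau> s c (h + w * a)) \<partial>complex_normal v)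
       = ennreal (smoothed_quad (\<tau> + v * (cmod w)\<^sup>2) s c h)"
proof -
  define k where "k = 1 + s * \<tau>"
  have k: "k > 0" using s \<tau> by (simp add: k_def add_pos_nonneg)
  define p where "p = s * (cmod w)\<^sup>2 / k"
  define e where "e = cnj w * (c - of_real s * h)"
  define d where "d = e / of_real k"
  have pv: "1 + p * v > 0" using s v k by (simp add: p_def add_pos_nonneg)
  define C where "C = exp ((quad_expo s c h + \<tau> * (cmod c)\<^sup>2) / k) / k"
  have C: "C \<ge> 0" using k by (simp add: C_def)
  have "smoothed_quad \<tau> s c (h + w * a) = C * exp (- p * (cmod a)\<^sup>2 + 2 * Re (a * cnj d))" for a
  proof -
    have "2 * Re (a * cnj d) = 2 * Re (a * cnj e) / k"
      by (simp add: d_def flip: of_real_mult)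
    then have "(quad_expo s c (h + w * a) + \<tau> * (cmod c)\<^sup>2) / k
      = (quad_expo s c h + \<tau> * (cmod c)\<^sup>2) / k + (- p * (cmod a)\<^sup>2 + 2 * Re (a * cnj d))"
      unfolding quad_expo_shift e_def[symmetric] p_def by (simp add: add_divide_distrib diff_divide_distrib)
    then show ?thesis
      unfolding smoothed_quad_def k_def[symmetric] C_def by (simp add: exp_add)
  qed
  then have "(\<integral>\<^sup>+a. ennreal (smoothed_quad \<tau> s c (h + w * a)) \<partial>complex_normal v)
     = (\<integral>\<^sup>+a. ennreal C * ennreal (exp (- p * (cmod a)\<^sup>2 + 2 * Re (a * cnj d))) \<partial>complex_normal v)"
    using C by (simp add: ennreal_mult)
  also have "\<dots> = ennreal (C * (exp (v * (cmod d)\<^sup>2 / (1 + p * v)) / (1 + p * v)))"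
    using C pv v
    by (subst nn_integral_cmult, simp, subst nn_integral_complex_normal)
       (auto simp flip: ennreal_mult)
  also have "C * (exp (v * (cmod d)\<^sup>2 / (1 + p * v)) / (1 + p * v)) = smoothed_quad (\<tau> + v * (cmod w)\<^sup>2) s c h"
  proof -
    define k' where "k' = 1 + s * (\<tau> + v * (cmod w)\<^sup>2)"
    have k': "k' > 0" using s v \<tau> by (simp add: k'_def add_pos_nonneg)
    have kk: "1 + p * v = k' / k" using k by (simp add: p_def k'_def k_def field_simps)
    have cd: "(cmod d)\<^sup>2 = (cmod w)\<^sup>2 * (cmod (c - of_real s * h))\<^sup>2 / k\<^sup>2"
      using k by (simp add: d_def e_def norm_mult norm_divide power_mult_distrib power_divide)
    \<comment> \<open>The squared norm created by the integration is affine in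
      \<open>quad_expo\<close> itself; this is why the family of integrands is closed under
      smoothing.\<close>
    have ch: "(cmod (c - of_real s * h))\<^sup>2 = (cmod c)\<^sup>2 - s * quad_expo s c h"
      unfolding quad_expo_def cmod_power2 by (simp add: power2_eq_square algebra_simps)
    have "(quad_expo s c h + \<tau> * (cmod c)\<^sup>2) / k + v * (cmod d)\<^sup>2 / (1 + p * v)
        = (quad_expo s c h + (\<tau> + v * (cmod w)\<^sup>2) * (cmod c)\<^sup>2) / k'"
    proof -
      define W where "W = v * (cmod w)\<^sup>2"
      define q where "q = quad_expo s c h"
      define n where "n = (cmod c)\<^sup>2"
      have "v * (cmod d)\<^sup>2 / (1 + p * v) = W * (n - s * q) / (k * k')"
        unfolding kk cd ch W_def n_def q_def using k k' by (simp add: field_simps power2_eq_square)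
      moreover have "(q + \<tau> * n) / k + W * (n - s * q) / (k * k') = (q + (\<tau> + W) * n) / k'"
      proof -
        \<comment> \<open>Since \<open>k' = k + s * W\<close>, the terms containing
          \<open>s * W * q\<close> cancel.\<close>
        have "(q + \<tau> * n) * k' + W * (n - s * q) = (q + (\<tau> + W) * n) * k"
          unfolding k'_def k_def W_def[symmetric] by (simp add: algebra_simps)
        then have "((q + \<tau> * n) * k' + W * (n - s * q)) / (k * k') = (q + (\<tau> + W) * n) * k / (k * k')"
          by simp
        then show ?thesis using k k' by (simp add: add_divide_distrib)
      qed
      ultimately show ?thesis by (simp add: W_def q_def n_def)
    qed
    then show ?thesis
      unfolding C_def smoothed_quad_def k'_def[symmetric] using k k'
      by (simp add: kk flip: exp_add)
  qed
  finally show ?thesis .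
qed

lemma cnj_measurable [measurable]: "cnj \<in> borel_measurable borel"
  by (intro borel_measurable_continuous_onI continuous_intros)

lemma smoothed_quad_measurable [measurable (raw)]:
  assumes [measurable]: "f \<in> borel_measurable M" "g \<in> borel_measurable M"
  shows "(\<lambda>x. smoothed_quad \<tau> s (f x) (g x)) \<in> borel_measurable M"
  unfolding smoothed_quad_def quad_expo_def by measurable

section \<open>Integrating out noise, matrix columns and auxiliary vectors\<close>

lemma product_prob_space_complex_normal:
  "v > 0 \<Longrightarrow> product_prob_space (\<lambda>_. complex_normal v)"
  by (intro product_prob_space.intro product_prob_space_axioms.intro product_sigma_finite.intro
      prob_space_complex_normal prob_space_imp_sigma_finite)

lemma nn_integral_smoothed_quad_noise:
  fixes N :: nat
  assumes v: "v > 0" and \<tau>: "0 \<le> \<tau>" and s: "0 \<le> s"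
  shows "(\<integral>\<^sup>+n. (\<Prod>i<N. ennreal (smoothed_quad \<tau> s (c i) (h i + n i))) \<partial>PiM {..<N} (\<lambda>_. complex_normal v))
       = (\<Prod>i<N. ennreal (smoothed_quad (\<tau> + v) s (c i) (h i)))"
proof -
  interpret product_prob_space "\<lambda>_. complex_normal v" "{..<N}"
    by (rule product_prob_space_complex_normal[OF v])
  show ?thesis
    using smoothed_quad_step[OF assms, of _ _ 1]
    by (subst product_nn_integral_prod) auto
qed

text \<open>For fixed \<open>x\<close>, each row sum is complex normal with variance the energy of
  \<open>x\<close> on \<open>S\<close>. Induction on the columns: the induction hypothesis is
  applied with column \<open>j\<close> absorbed into the offset, hence the arbitrary
  \<open>h\<close>; integrating column \<open>j\<close> then adds its own variance.\<close>

lemma nn_integral_smoothed_quad_columns: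
  fixes N :: nat and x :: "nat \<Rightarrow> complex"
  assumes "finite S" and \<tau>: "0 \<le> \<tau>" and s: "0 \<le> s"
  shows "(\<integral>\<^sup>+A. (\<Prod>i<N. ennreal (smoothed_quad \<tau> s (c i) (h i + (\<Sum>j\<in>S. A (i, j) * x j))))
            \<partial>PiM ({..<N} \<times> S) (\<lambda>_. complex_normal 1))
       = (\<Prod>i<N. ennreal (smoothed_quad (\<tau> + (\<Sum>j\<in>S. (cmod (x j))\<^sup>2)) s (c i) (h i)))"
  using assms(1)
proof (induction S arbitrary: h)
  case empty
  interpret P: prob_space "PiM ({}::(nat \<times> nat) set) (\<lambda>_. complex_normal 1)"
    by (rule prob_space_PiM) simp
  show ?case by (simp add: P.emeasure_space_1)
next
  case (insert j S)
  interpret product_prob_space "\<lambda>_. complex_normal 1" UNIV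
    by (rule product_prob_space_complex_normal) simp
  let ?\<tau> = "\<tau> + (\<Sum>j\<in>S. (cmod (x j))\<^sup>2)"
  have \<tau>': "0 \<le> ?\<tau>" using \<tau> by (simp add: sum_nonneg)
  have split: "{..<N} \<times> insert j S = {..<N} \<times> {j} \<union> {..<N} \<times> S" by auto
  have "(\<integral>\<^sup>+A. (\<Prod>i<N. ennreal (smoothed_quad \<tau> s (c i) (h i + (\<Sum>j\<in>insert j S. A (i, j) * x j))))
            \<partial>PiM ({..<N} \<times> insert j S) (\<lambda>_. complex_normal 1))
     = (\<integral>\<^sup>+X. (\<integral>\<^sup>+Y. (\<Prod>i<N. ennreal (smoothed_quad \<tau> s (c i) (h i +
            (\<Sum>j'\<in>insert j S. merge ({..<N} \<times> {j}) ({..<N} \<times> S) (X, Y) (i, j') * x j'))))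
            \<partial>PiM ({..<N} \<times> S) (\<lambda>_. complex_normal 1)) \<partial>PiM ({..<N} \<times> {j}) (\<lambda>_. complex_normal 1))"
    unfolding split using insert.hyps by (subst product_nn_integral_fold) auto
  also have "\<dots> = (\<integral>\<^sup>+X. (\<integral>\<^sup>+Y. (\<Prod>i<N. ennreal (smoothed_quad \<tau> s (c i) ((h i + X (i, j) * x j) +
            (\<Sum>j'\<in>S. Y (i, j') * x j'))))
            \<partial>PiM ({..<N} \<times> S) (\<lambda>_. complex_normal 1)) \<partial>PiM ({..<N} \<times> {j}) (\<lambda>_. complex_normal 1))"
  proof (intro nn_integral_cong prod.cong refl arg_cong[where f = ennreal]
      arg_cong[where f = "smoothed_quad \<tau> s _"])
    fix X Y i assume i: "i \<in> {..<N}"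
    have "(\<Sum>j'\<in>S. merge ({..<N} \<times> {j}) ({..<N} \<times> S) (X, Y) (i, j') * x j') = (\<Sum>j'\<in>S. Y (i, j') * x j')"
      using i insert.hyps by (intro sum.cong) (auto simp: merge_def)
    then show "h i + (\<Sum>j'\<in>insert j S. merge ({..<N} \<times> {j}) ({..<N} \<times> S) (X, Y) (i, j') * x j')
        = h i + X (i, j) * x j + (\<Sum>j'\<in>S. Y (i, j') * x j')"
      using i insert.hyps by (simp add: merge_def)
  qed
  also have "\<dots> = (\<integral>\<^sup>+X. (\<Prod>i<N. ennreal (smoothed_quad ?\<tau> s (c i) (h i + X (i, j) * x j)))
            \<partial>PiM ({..<N} \<times> {j}) (\<lambda>_. complex_normal 1))"
    by (simp only: insert.IH)
  also have "\<dots> = (\<integral>\<^sup>+X. (\<Prod>p\<in>{..<N} \<times> {j}. ennreal (smoothed_quad ?\<tau> s (c (fst p)) (h (fst p) + x j * X p)))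
            \<partial>PiM ({..<N} \<times> {j}) (\<lambda>_. complex_normal 1))"
    by (simp add: prod.cartesian_product' mult.commute)
  also have "\<dots> = (\<Prod>p\<in>{..<N} \<times> {j}. ennreal (smoothed_quad (?\<tau> + (cmod (x j))\<^sup>2) s (c (fst p)) (h (fst p))))"
    using smoothed_quad_step[OF _ \<tau>' s, of 1]
    by (subst product_nn_integral_prod) auto
  also have "\<dots> = (\<Prod>i<N. ennreal (smoothed_quad (\<tau> + (\<Sum>j\<in>insert j S. (cmod (x j))\<^sup>2)) s (c i) (h i)))"
    using insert.hyps by (simp add: prod.cartesian_product' add_ac)
  finally show ?case .
qed

text \<open>The Hubbard-Stratonovich identity. Read from right to left, it replaces the exponential
  of an energy by an average of exponentials linear in \<open>a\<close>. Each coordinate is the case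
  \<open>p = 0\<close> of the Gaussian integral.\<close>

lemma nn_integral_exp_linear:
  assumes "finite K"
  shows "(\<integral>\<^sup>+w. ennreal (exp (2 * Re (\<Sum>k\<in>K. a k * cnj (w k)))) \<partial>PiM K (\<lambda>_. complex_normal 1))
       = ennreal (exp (\<Sum>k\<in>K. (cmod (a k))\<^sup>2))"
proof -
  interpret product_prob_space "\<lambda>_. complex_normal 1" K
    by (rule product_prob_space_complex_normal) simp
  have "(\<integral>\<^sup>+z. ennreal (exp (2 * Re (a k * cnj z))) \<partial>complex_normal 1) = ennreal (exp ((cmod (a k))\<^sup>2))" for k
    using nn_integral_complex_normal[of 1 0 "a k"] by (simp add: mult.commute)
  moreover have "ennreal (exp (2 * Re (\<Sum>k\<in>K. a k * cnj (w k)))) = (\<Prod>k\<in>K. ennreal (exp (2 * Re (a k * cnj (w k)))))" for w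
    unfolding Re_sum sum_distrib_left exp_sum[OF assms] by (simp add: prod_ennreal)
  ultimately show ?thesis
    using assms by (simp only:) (subst product_nn_integral_prod, auto simp: exp_sum prod_ennreal)
qed

text \<open>Each coordinate is the Gaussian integral with \<open>p = - \<theta>\<close> and
  \<open>d = 0\<close>. It serves both the noise tail and the final integration over the auxiliary
  vector.\<close>

lemma nn_integral_exp_energy:
  assumes "finite K" and v: "v > 0" and "\<theta> * v < 1"
  shows "(\<integral>\<^sup>+w. ennreal (exp (\<theta> * (\<Sum>k\<in>K. (cmod (w k))\<^sup>2))) \<partial>PiM K (\<lambda>_. complex_normal v))
       = ennreal ((1 / (1 - \<theta> * v)) ^ card K)"
proof -
  interpret product_prob_space "\<lambda>_. complex_normal v" K
    by (rule product_prob_space_complex_normal[OF v])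
  have "(\<integral>\<^sup>+z. ennreal (exp (\<theta> * (cmod z)\<^sup>2)) \<partial>complex_normal v) = ennreal (1 / (1 - \<theta> * v))"
    using nn_integral_complex_normal[of v "- \<theta>" 0] assms by simp
  moreover have "ennreal (exp (\<theta> * (\<Sum>k\<in>K. (cmod (w k))\<^sup>2))) = (\<Prod>k\<in>K. ennreal (exp (\<theta> * (cmod (w k))\<^sup>2)))" for w
    unfolding sum_distrib_left exp_sum[OF assms(1)] by (simp add: prod_ennreal)
  ultimately show ?thesis
    using assms by (simp only:) (subst product_nn_integral_prod, auto simp: ennreal_power)
qed

section \<open>Projections\<close>

text \<open>Zero vectors are allowed, so that Gram-Schmidt keeps the index set even for dependent columns.\<close>

definition semi_orthonormal :: "'i set \<Rightarrow> 'k set \<Rightarrow> ('k \<Rightarrow> 'i \<Rightarrow> complex) \<Rightarrow> bool" where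
  "semi_orthonormal I K u \<longleftrightarrow>
     (\<forall>k\<in>K. \<forall>l\<in>K. k \<noteq> l \<longrightarrow> (\<Sum>i\<in>I. u k i * cnj (u l i)) = 0) \<and>
     (\<forall>k\<in>K. (\<Sum>i\<in>I. u k i * cnj (u k i)) \<in> {0, 1})"

lemma sum_mult_cnj_eq_0:
  assumes "finite I" and "(\<Sum>i\<in>I. u i * cnj (u i)) = 0" and "i \<in> I"
  shows "u i = (0::complex)"
proof -
  have "(\<Sum>i\<in>I. u i * cnj (u i)) = of_real (\<Sum>i\<in>I. (cmod (u i))\<^sup>2)"
    by (simp only: of_real_sum complex_norm_square)
  then have "(\<Sum>i\<in>I. (cmod (u i))\<^sup>2) = 0" using assms(2) by (metis of_real_eq_0_iff)
  then show ?thesis using assms by (subst (asm) sum_nonneg_eq_0_iff) auto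
qed

lemma semi_orthonormal_inner_sum:
  assumes "finite K" and u: "semi_orthonormal I K u" and l: "l \<in> K"
  shows "(\<Sum>i\<in>I. (\<Sum>k\<in>K. c k * u k i) * cnj (u l i)) = c l * (\<Sum>i\<in>I. u l i * cnj (u l i))"
proof -
  have "(\<Sum>i\<in>I. (\<Sum>k\<in>K. c k * u k i) * cnj (u l i)) = (\<Sum>k\<in>K. c k * (\<Sum>i\<in>I. u k i * cnj (u l i)))"
    unfolding sum_distrib_left sum_distrib_right by (subst sum.swap) (simp add: mult.assoc)
  also have "\<dots> = (\<Sum>k\<in>K. if k = l then c l * (\<Sum>i\<in>I. u l i * cnj (u l i)) else 0)"
    using u l by (intro sum.cong) (auto simp: semi_orthonormal_def)
  finally show ?thesis using assms by simp
qed

lemma semi_orthonormal_energy: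
  assumes "finite K" and u: "semi_orthonormal I K u"
  shows "of_real (\<Sum>i\<in>I. (cmod (\<Sum>k\<in>K. c k * u k i))\<^sup>2)
       = (\<Sum>k\<in>K. c k * cnj (c k) * (\<Sum>i\<in>I. u k i * cnj (u k i)))"
proof -
  have "of_real (\<Sum>i\<in>I. (cmod (\<Sum>k\<in>K. c k * u k i))\<^sup>2)
     = (\<Sum>i\<in>I. (\<Sum>k\<in>K. c k * u k i) * (\<Sum>l\<in>K. cnj (c l) * cnj (u l i)))"
    by (simp only: of_real_sum complex_norm_square cnj_sum complex_cnj_mult)
  also have "\<dots> = (\<Sum>l\<in>K. cnj (c l) * (\<Sum>i\<in>I. (\<Sum>k\<in>K. c k * u k i) * cnj (u l i)))"
    unfolding sum_distrib_left by (subst sum.swap) (simp add: mult_ac)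
  also have "\<dots> = (\<Sum>l\<in>K. cnj (c l) * (c l * (\<Sum>i\<in>I. u l i * cnj (u l i))))"
    using assms by (simp add: semi_orthonormal_inner_sum)
  finally show ?thesis by (simp add: mult_ac)
qed

text \<open>Pythagoras; only an inequality, since the terms belonging to zero vectors vanish on the
  left.\<close>

lemma semi_orthonormal_energy_le:
  assumes "finite K" and u: "semi_orthonormal I K u"
  shows "(\<Sum>i\<in>I. (cmod (\<Sum>k\<in>K. c k * u k i))\<^sup>2) \<le> (\<Sum>k\<in>K. (cmod (c k))\<^sup>2)"
proof -
  have "(\<Sum>i\<in>I. (cmod (\<Sum>k\<in>K. c k * u k i))\<^sup>2)
     = Re (\<Sum>k\<in>K. c k * cnj (c k) * (\<Sum>i\<in>I. u k i * cnj (u k i)))"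
    using semi_orthonormal_energy[OF assms, of c] by (metis Re_complex_of_real)
  also have "\<dots> \<le> (\<Sum>k\<in>K. (cmod (c k))\<^sup>2)"
    unfolding Re_sum
  proof (rule sum_mono)
    fix k assume "k \<in> K"
    define e where "e = (\<Sum>i\<in>I. u k i * cnj (u k i))"
    have "e \<in> {0, 1}" using u \<open>k \<in> K\<close> by (auto simp: semi_orthonormal_def e_def)
    then show "Re (c k * cnj (c k) * (\<Sum>i\<in>I. u k i * cnj (u k i))) \<le> (cmod (c k))\<^sup>2"
      unfolding complex_norm_square[of "c k", symmetric] e_def[symmetric] by auto
  qed
  finally show ?thesis .
qed

text \<open>The orthogonal projection is the best approximation: the left side is the squared
  distance of \<open>g\<close> to the span, the right side that to an arbitrary element of
  it.\<close>

lemma semi_orthonormal_dist: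
  assumes "finite I" and "finite K" and u: "semi_orthonormal I K u"
  shows "(\<Sum>i\<in>I. (cmod (g i))\<^sup>2) - (\<Sum>k\<in>K. (cmod (\<Sum>i\<in>I. g i * cnj (u k i)))\<^sup>2)
       \<le> (\<Sum>i\<in>I. (cmod (g i - (\<Sum>k\<in>K. c k * u k i)))\<^sup>2)"
proof -
  define b where "b k = (\<Sum>i\<in>I. g i * cnj (u k i))" for k
  define v where "v i = (\<Sum>k\<in>K. c k * u k i)" for i
  define e where "e k = (\<Sum>i\<in>I. u k i * cnj (u k i))" for k
  have cross: "(\<Sum>i\<in>I. g i * cnj (v i)) = (\<Sum>k\<in>K. b k * cnj (c k))"
    unfolding v_def b_def cnj_sum complex_cnj_mult sum_distrib_left sum_distrib_right
    by (subst sum.swap) (simp add: mult_ac)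
  have "(\<Sum>i\<in>I. (cmod (v i))\<^sup>2) = Re (\<Sum>k\<in>K. c k * cnj (c k) * e k)"
    using semi_orthonormal_energy[OF assms(2,3), of c] unfolding v_def e_def by (metis Re_complex_of_real)
  moreover have "(\<Sum>i\<in>I. (cmod (g i - v i))\<^sup>2)
     = (\<Sum>i\<in>I. (cmod (g i))\<^sup>2) - 2 * Re (\<Sum>i\<in>I. g i * cnj (v i)) + (\<Sum>i\<in>I. (cmod (v i))\<^sup>2)"
    unfolding Re_sum sum_distrib_left sum_subtractf[symmetric] sum.distrib[symmetric]
    by (intro sum.cong refl, unfold cmod_power2) (simp add: power2_eq_square algebra_simps)
  \<comment> \<open>The gap between the two sides splits over \<open>k\<close>: a unit vector
    contributes |b k - c k|^2, a zero vector contributes nothing because then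
    \<open>b k = 0\<close>.\<close>
  moreover have "0 \<le> (\<Sum>k\<in>K. (cmod (b k))\<^sup>2 - 2 * Re (b k * cnj (c k)) + Re (c k * cnj (c k) * e k))"
  proof (rule sum_nonneg)
    fix k assume k: "k \<in> K"
    then have "e k = 0 \<or> e k = 1" using u by (auto simp: semi_orthonormal_def e_def)
    then show "0 \<le> (cmod (b k))\<^sup>2 - 2 * Re (b k * cnj (c k)) + Re (c k * cnj (c k) * e k)"
    proof
      assume "e k = 0"
      then have "u k i = 0" if "i \<in> I" for i
        using sum_mult_cnj_eq_0[OF assms(1) _ that] by (simp add: e_def)
      then have "b k = 0" by (simp add: b_def)
      with \<open>e k = 0\<close> show ?thesis by simp
    next
      assume "e k = 1"
      then have "(cmod (b k))\<^sup>2 - 2 * Re (b k * cnj (c k)) + Re (c k * cnj (c k) * e k) = (cmod (b k - c k))\<^sup>2"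
        unfolding cmod_power2 by (simp add: power2_eq_square algebra_simps)
      then show ?thesis by simp
    qed
  qed
  ultimately show ?thesis
    unfolding v_def[symmetric] b_def[symmetric] cross
    by (simp only: Re_sum sum_distrib_left sum.distrib sum_subtractf)
qed

text \<open>Each new vector is reduced by its projection and normalised. A dependent vector leaves
  remainder zero and contributes a zero vector, so the family keeps the index set
  \<open>J\<close>.\<close>

lemma gram_schmidt:
  assumes "finite I" and "finite J"
  shows "\<exists>u. semi_orthonormal I J u \<and> (\<forall>j\<in>J. \<exists>c. \<forall>i\<in>I. a j i = (\<Sum>k\<in>J. c k * u k i))"
  using assms(2)
proof induction
  case empty
  show ?case by (simp add: semi_orthonormal_def)
next
  case (insert j J)
  then obtain u where u: "semi_orthonormal I J u"
    and span: "\<And>j. j \<in> J \<Longrightarrow> \<exists>c. \<forall>i\<in>I. a j i = (\<Sum>k\<in>J. c k * u k i)" by blast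
  define p where "p k = (\<Sum>i\<in>I. a j i * cnj (u k i))" for k
  define r where "r i = a j i - (\<Sum>k\<in>J. p k * u k i)" for i
  define n where "n = sqrt (\<Sum>i\<in>I. (cmod (r i))\<^sup>2)"
  \<comment> \<open>If \<open>n = 0\<close>, division by zero yields the zero vector, one of the two
    lengths that \<open>semi_orthonormal\<close> admits.\<close>
  define u' where "u' = u(j := (\<lambda>i. r i / of_real n))"
  have same: "u' k = u k" if "k \<in> J" for k using that insert.hyps by (auto simp: u'_def)
  have n2: "(\<Sum>i\<in>I. r i * cnj (r i)) = (of_real n)\<^sup>2"
    unfolding n_def by (simp add: sum_nonneg complex_norm_square flip: of_real_power)
  have r0: "r i = of_real n * u' j i" if "i \<in> I" for i
  proof (cases "n = 0")
    case True
    then show ?thesis using sum_mult_cnj_eq_0[OF assms(1) _ that, of r] n2 by simp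
  qed (simp add: u'_def)
  have orth: "(\<Sum>i\<in>I. r i * cnj (u l i)) = 0" if l: "l \<in> J" for l
  proof -
    have "(\<Sum>i\<in>I. r i * cnj (u l i)) = p l - p l * (\<Sum>i\<in>I. u l i * cnj (u l i))"
      using semi_orthonormal_inner_sum[OF insert.hyps(1) u l, of p]
      by (simp add: r_def left_diff_distrib sum_subtractf p_def[of l])
    moreover have "(\<Sum>i\<in>I. u l i * cnj (u l i)) \<in> {0, 1}" using u l by (auto simp: semi_orthonormal_def)
    moreover have "p l = 0" if "(\<Sum>i\<in>I. u l i * cnj (u l i)) = 0"
      using sum_mult_cnj_eq_0[OF assms(1) that] by (simp add: p_def)
    ultimately show ?thesis by auto
  qed
  have orth1: "(\<Sum>i\<in>I. u' j i * cnj (u l i)) = 0" if "l \<in> J" for l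
    using orth[OF that] by (simp add: u'_def flip: sum_divide_distrib)
  have orth2: "(\<Sum>i\<in>I. u l i * cnj (u' j i)) = 0" if "l \<in> J" for l
    using arg_cong[OF orth1[OF that], of cnj] by (simp add: cnj_sum mult.commute)
  have "(\<Sum>i\<in>I. u' j i * cnj (u' j i)) = (of_real n)\<^sup>2 / (of_real n)\<^sup>2"
    unfolding n2[symmetric] by (simp add: u'_def power2_eq_square n2 flip: sum_divide_distrib)
  then have nrm: "(\<Sum>i\<in>I. u' j i * cnj (u' j i)) \<in> {0, 1}" by (cases "n = 0") auto
  have "semi_orthonormal I (insert j J) u'"
    using u nrm orth1 orth2 same unfolding semi_orthonormal_def by auto
  moreover have "\<exists>c. \<forall>i\<in>I. a l i = (\<Sum>k\<in>insert j J. c k * u' k i)" if l: "l \<in> insert j J" for l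
  proof (cases "l = j")
    case True
    have "a j i = (\<Sum>k\<in>insert j J. (p(j := of_real n)) k * u' k i)" if "i \<in> I" for i
    proof -
      have "(\<Sum>k\<in>J. (p(j := of_real n)) k * u' k i) = (\<Sum>k\<in>J. p k * u k i)"
        using insert.hyps same by (intro sum.cong) auto
      then show ?thesis using insert.hyps r0[OF that] by (simp add: r_def algebra_simps)
    qed
    with True show ?thesis by blast
  next
    case False
    then obtain c where c: "\<forall>i\<in>I. a l i = (\<Sum>k\<in>J. c k * u k i)" using span l by blast
    have "a l i = (\<Sum>k\<in>insert j J. (c(j := 0)) k * u' k i)" if "i \<in> I" for i
    proof -
      have "(\<Sum>k\<in>J. (c(j := 0)) k * u' k i) = (\<Sum>k\<in>J. c k * u k i)"
        using insert.hyps same by (intro sum.cong) auto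
      then show ?thesis using insert.hyps c that by simp
    qed
    then show ?thesis by blast
  qed
  ultimately show ?case by blast
qed

text \<open>After linearisation the integrand factors over the coordinates; noise and columns
  together smooth it with variance \<open>\<sigma>\<close>. Integrating the auxiliary
  \<open>w\<close> last gives back one factor \<open>1 + s * \<sigma>\<close> per direction, as for
  a sum of \<open>N - card K\<close> exponentials of mean \<open>\<sigma>\<close>. Zero vectors
  project out nothing, hence an inequality.\<close>

lemma laplace_residual:
  fixes N :: nat and x :: "nat \<Rightarrow> complex" and u :: "'k \<Rightarrow> nat \<Rightarrow> complex"
  assumes "finite S" and "finite K" and u: "semi_orthonormal {..<N} K u" and v: "v > 0" and s: "0 \<le> s"
  shows "(\<integral>\<^sup>+A. \<integral>\<^sup>+n. ennreal (exp (- s * ((\<Sum>i<N. (cmod ((\<Sum>j\<in>S. A (i, j) * x j) + n i))\<^sup>2)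
              - (\<Sum>k\<in>K. (cmod (\<Sum>i<N. ((\<Sum>j\<in>S. A (i, j) * x j) + n i) * cnj (u k i)))\<^sup>2))))
            \<partial>PiM {..<N} (\<lambda>_. complex_normal v) \<partial>PiM ({..<N} \<times> S) (\<lambda>_. complex_normal 1))
     \<le> ennreal ((1 + s * (v + (\<Sum>j\<in>S. (cmod (x j))\<^sup>2))) ^ card K
              / (1 + s * (v + (\<Sum>j\<in>S. (cmod (x j))\<^sup>2))) ^ N)"
proof -
  define W where "W = PiM K (\<lambda>_. complex_normal 1)"
  define Z where "Z = PiM {..<N} (\<lambda>_. complex_normal v)"
  define X where "X = PiM ({..<N} \<times> S) (\<lambda>_. complex_normal 1)"
  define \<sigma> where "\<sigma> = v + (\<Sum>j\<in>S. (cmod (x j))\<^sup>2)"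
  \<comment> \<open>The factor \<open>sqrt s\<close> makes the Hubbard-Stratonovich identity produce
    \<open>s\<close> times the projected energy.\<close>
  define b where "b w i = of_real (sqrt s) * (\<Sum>k\<in>K. w k * u k i)" for w and i :: nat
  define F where "F A i = (\<Sum>j\<in>S. A (i, j) * x j)" for A and i :: nat
  have \<sigma>: "\<sigma> > 0" using v by (simp add: \<sigma>_def add_pos_nonneg sum_nonneg)
  interpret W: prob_space W unfolding W_def by (intro prob_space_PiM prob_space_complex_normal) simp
  interpret Z: prob_space Z unfolding Z_def by (intro prob_space_PiM prob_space_complex_normal v)
  interpret X: prob_space X unfolding X_def by (intro prob_space_PiM prob_space_complex_normal) simp
  interpret WZ: pair_sigma_finite W Z ..
  interpret WX: pair_sigma_finite W X ..
  have [measurable_cong]: "sets W = sets (PiM K (\<lambda>_. borel))" "sets Z = sets (PiM {..<N} (\<lambda>_. borel))"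
     "sets X = sets (PiM ({..<N} \<times> S) (\<lambda>_. borel))"
    by (auto simp: W_def Z_def X_def intro!: sets_PiM_cong)
  have linearize: "ennreal (exp (- s * ((\<Sum>i<N. (cmod (h i))\<^sup>2) - (\<Sum>k\<in>K. (cmod (\<Sum>i<N. h i * cnj (u k i)))\<^sup>2))))
     = (\<integral>\<^sup>+w. (\<Prod>i<N. ennreal (smoothed_quad 0 s (b w i) (h i))) \<partial>W)" for h
  proof -
    define a where "a k = of_real (sqrt s) * (\<Sum>i<N. h i * cnj (u k i))" for k
    have "(\<Sum>i<N. h i * cnj (b w i)) = (\<Sum>k\<in>K. a k * cnj (w k))" for w
      unfolding a_def b_def cnj_sum complex_cnj_mult complex_cnj_complex_of_real sum_distrib_left sum_distrib_right
      by (subst sum.swap) (simp add: mult_ac)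
    then have "(\<Sum>i<N. quad_expo s (b w i) (h i))
       = - s * (\<Sum>i<N. (cmod (h i))\<^sup>2) + 2 * Re (\<Sum>k\<in>K. a k * cnj (w k))" for w
      unfolding quad_expo_def sum.distrib sum_distrib_left[symmetric] Re_sum[symmetric] by simp
    then have "(\<Prod>i<N. ennreal (smoothed_quad 0 s (b w i) (h i)))
       = ennreal (exp (- s * (\<Sum>i<N. (cmod (h i))\<^sup>2))) * ennreal (exp (2 * Re (\<Sum>k\<in>K. a k * cnj (w k))))" for w
      by (simp add: smoothed_quad_def prod_ennreal mult_exp_exp flip: exp_sum ennreal_mult)
    then have "(\<integral>\<^sup>+w. (\<Prod>i<N. ennreal (smoothed_quad 0 s (b w i) (h i))) \<partial>W)
       = ennreal (exp (- s * (\<Sum>i<N. (cmod (h i))\<^sup>2))) * ennreal (exp (\<Sum>k\<in>K. (cmod (a k))\<^sup>2))"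
      unfolding nn_integral_exp_linear[OF assms(2), symmetric] W_def[symmetric]
      by (simp only:) (rule nn_integral_cmult, measurable)
    also have "(\<Sum>k\<in>K. (cmod (a k))\<^sup>2) = s * (\<Sum>k\<in>K. (cmod (\<Sum>i<N. h i * cnj (u k i)))\<^sup>2)"
      unfolding a_def norm_mult power_mult_distrib using s by (simp flip: sum_distrib_left)
    finally show ?thesis by (simp add: right_diff_distrib mult_exp_exp flip: ennreal_mult)
  qed
  have "(\<integral>\<^sup>+A. \<integral>\<^sup>+n. ennreal (exp (- s * ((\<Sum>i<N. (cmod (F A i + n i))\<^sup>2)
              - (\<Sum>k\<in>K. (cmod (\<Sum>i<N. (F A i + n i) * cnj (u k i)))\<^sup>2)))) \<partial>Z \<partial>X)
     = (\<integral>\<^sup>+A. \<integral>\<^sup>+n. \<integral>\<^sup>+w. (\<Prod>i<N. ennreal (smoothed_quad 0 s (b w i) (F A i + n i))) \<partial>W \<partial>Z \<partial>X)"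
    by (simp only: linearize)
  \<comment> \<open>Tonelli moves \<open>w\<close> outwards, because only for fixed \<open>w\<close>
    is the integrand a product over the coordinates. The case \<open>\<tau> = 0\<close> of
    \<open>smoothed_quad\<close> is the unsmoothed exponential.\<close>
  also have "\<dots> = (\<integral>\<^sup>+A. \<integral>\<^sup>+w. \<integral>\<^sup>+n. (\<Prod>i<N. ennreal (smoothed_quad 0 s (b w i) (F A i + n i))) \<partial>Z \<partial>W \<partial>X)"
    unfolding b_def by (intro nn_integral_cong WZ.Fubini') measurable
  also have "\<dots> = (\<integral>\<^sup>+A. \<integral>\<^sup>+w. (\<Prod>i<N. ennreal (smoothed_quad v s (b w i) (0 + F A i))) \<partial>W \<partial>X)"
    unfolding Z_def by (subst nn_integral_smoothed_quad_noise) (use v s in auto)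
  also have "\<dots> = (\<integral>\<^sup>+w. \<integral>\<^sup>+A. (\<Prod>i<N. ennreal (smoothed_quad v s (b w i) (0 + F A i))) \<partial>X \<partial>W)"
    unfolding b_def F_def by (intro WX.Fubini') measurable
  also have "\<dots> = (\<integral>\<^sup>+w. (\<Prod>i<N. ennreal (smoothed_quad \<sigma> s (b w i) 0)) \<partial>W)"
    unfolding X_def F_def \<sigma>_def
    by (subst nn_integral_smoothed_quad_columns) (use assms in auto)
  \<comment> \<open>At \<open>h = 0\<close> only the term in |b|^2 survives in the exponent.
    \<open>semi_orthonormal_energy_le\<close> bounds it by a multiple of the energy of
    \<open>w\<close> with coefficient below 1, so its exponential moment is finite.\<close>
  also have "\<dots> \<le> (\<integral>\<^sup>+w. ennreal (1 / (1 + s * \<sigma>) ^ N) * ennreal (exp (s * \<sigma> / (1 + s * \<sigma>) * (\<Sum>k\<in>K. (cmod (w k))\<^sup>2))) \<partial>W)"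
  proof (rule nn_integral_mono)
    fix w
    have "(\<Sum>i<N. (cmod (b w i))\<^sup>2) \<le> s * (\<Sum>k\<in>K. (cmod (w k))\<^sup>2)"
      unfolding b_def norm_mult power_mult_distrib
      using s semi_orthonormal_energy_le[OF assms(2) u, of w]
      by (simp add: mult_left_mono flip: sum_distrib_left)
    then have *: "\<sigma> / (1 + s * \<sigma>) * (\<Sum>i<N. (cmod (b w i))\<^sup>2) \<le> \<sigma> / (1 + s * \<sigma>) * (s * (\<Sum>k\<in>K. (cmod (w k))\<^sup>2))"
      using s \<sigma> by (intro mult_left_mono) auto
    have "(\<Prod>i<N. ennreal (smoothed_quad \<sigma> s (b w i) 0))
      = ennreal (exp (\<sigma> / (1 + s * \<sigma>) * (\<Sum>i<N. (cmod (b w i))\<^sup>2)) / (1 + s * \<sigma>) ^ N)"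
      using s \<sigma> by (simp add: prod_ennreal smoothed_quad_def quad_expo_def prod_dividef sum_distrib_left flip: exp_sum)
    also have "\<dots> \<le> ennreal (exp (s * \<sigma> / (1 + s * \<sigma>) * (\<Sum>k\<in>K. (cmod (w k))\<^sup>2)) / (1 + s * \<sigma>) ^ N)"
      using * s \<sigma> by (intro ennreal_leI divide_right_mono) (auto simp: mult_ac)
    finally show "(\<Prod>i<N. ennreal (smoothed_quad \<sigma> s (b w i) 0))
      \<le> ennreal (1 / (1 + s * \<sigma>) ^ N) * ennreal (exp (s * \<sigma> / (1 + s * \<sigma>) * (\<Sum>k\<in>K. (cmod (w k))\<^sup>2)))"
      using s \<sigma> by (simp flip: ennreal_mult)
  qed
  also have "\<dots> = ennreal (1 / (1 + s * \<sigma>) ^ N) * ennreal ((1 / (1 - s * \<sigma> / (1 + s * \<sigma>) * 1)) ^ card K)"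
  proof -
    have "s * \<sigma> / (1 + s * \<sigma>) * 1 < 1" using s \<sigma> by (simp add: add_pos_nonneg)
    then have "(\<integral>\<^sup>+w. ennreal (exp (s * \<sigma> / (1 + s * \<sigma>) * (\<Sum>k\<in>K. (cmod (w k))\<^sup>2))) \<partial>W)
       = ennreal ((1 / (1 - s * \<sigma> / (1 + s * \<sigma>) * 1)) ^ card K)"
      unfolding W_def using assms(2) by (intro nn_integral_exp_energy) auto
    moreover have "(\<lambda>w. ennreal (exp (s * \<sigma> / (1 + s * \<sigma>) * (\<Sum>k\<in>K. (cmod (w k))\<^sup>2)))) \<in> borel_measurable W"
      by measurable
    ultimately show ?thesis by (simp only: nn_integral_cmult)
  qed
  also have "1 / (1 - s * \<sigma> / (1 + s * \<sigma>) * 1) = 1 + s * \<sigma>"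
    using s \<sigma> by (simp add: field_simps add_pos_nonneg add_nonneg_eq_0_iff)
  also have "ennreal (1 / (1 + s * \<sigma>) ^ N) * ennreal ((1 + s * \<sigma>) ^ card K) = ennreal ((1 + s * \<sigma>) ^ card K / (1 + s * \<sigma>) ^ N)"
    using s \<sigma> by (simp flip: ennreal_mult)
  finally show ?thesis by (simp only: X_def Z_def F_def \<sigma>_def)
qed

section \<open>Exhaustive search\<close>

definition residual :: "nat \<Rightarrow> nat set \<Rightarrow> (nat \<times> nat \<Rightarrow> complex) \<Rightarrow> (nat \<Rightarrow> complex) \<Rightarrow> (nat \<Rightarrow> complex) \<Rightarrow> real" where
  "residual N J A y z = (\<Sum>i<N. (cmod (y i - (\<Sum>j\<in>J. A (i, j) * z j)))\<^sup>2)"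

text \<open>Coefficients range over a countable set \<open>D\<close>, dense below, so that fitting is a measurable event.\<close>

definition fits :: "complex set \<Rightarrow> nat \<Rightarrow> real \<Rightarrow> (nat \<times> nat \<Rightarrow> complex) \<Rightarrow> (nat \<Rightarrow> complex) \<Rightarrow> nat set \<Rightarrow> bool" where
  "fits D N t A y J \<longleftrightarrow> (\<exists>z \<in> PiE J (\<lambda>_. D). residual N J A y z < t)"

lemma fits_measurable:
  assumes "countable D" and "finite J"
    and [measurable]: "\<And>i j. i < N \<Longrightarrow> j \<in> J \<Longrightarrow> (\<lambda>\<omega>. A \<omega> (i, j)) \<in> borel_measurable \<Omega>"
      "\<And>i. i < N \<Longrightarrow> (\<lambda>\<omega>. y \<omega> i) \<in> borel_measurable \<Omega>"
  shows "Measurable.pred \<Omega> (\<lambda>\<omega>. fits D N t (A \<omega>) (y \<omega>) J)"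
  unfolding fits_def residual_def
  unfolding pred_def
proof (rule sets.sets_Collect_countable_Ex')
  show "countable (PiE J (\<lambda>_. D))" using assms(1,2) by (intro countable_PiE)
qed measurable

text \<open>The residual is continuous in the coefficients, so a strict inequality survives
  approximation by coefficients from the dense set \<open>D\<close>.\<close>

lemma fits_if_residual_less:
  assumes D: "closure D = UNIV" and "finite J" and less: "residual N J A y x < t"
  shows "fits D N t A y J"
proof -
  have "\<forall>j. \<exists>f. (\<forall>n. f n \<in> D) \<and> f \<longlonglongrightarrow> x j"
    using D closure_sequential[of _ D] by blast
  then obtain f where f: "\<And>j n. f j n \<in> D" "\<And>j. f j \<longlonglongrightarrow> x j" by metis
  define z where "z n = (\<lambda>j\<in>J. f j n)" for n
  have "(\<lambda>n. residual N J A y (\<lambda>j. f j n)) \<longlonglongrightarrow> residual N J A y x"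
    unfolding residual_def by (intro tendsto_intros f)
  then have "eventually (\<lambda>n. residual N J A y (\<lambda>j. f j n) < t) sequentially"
    using less by (rule order_tendstoD)
  then obtain n where "residual N J A y (\<lambda>j. f j n) < t" by (auto simp: eventually_sequentially)
  moreover have "residual N J A y (z n) = residual N J A y (\<lambda>j. f j n)"
    by (simp add: residual_def z_def)
  moreover have "z n \<in> PiE J (\<lambda>_. D)" using f by (auto simp: z_def)
  ultimately show ?thesis unfolding fits_def by (metis (no_types, lifting))
qed

text \<open>If nothing fits, any \<open>L\<close>-element set is returned, because an algorithm must
  always output \<open>L\<close> nonzero entries. The choice depends on the data only through the
  family \<open>F\<close>, which keeps it measurable.\<close>

definition search_select :: "nat \<Rightarrow> nat \<Rightarrow> nat set set \<Rightarrow> nat set" where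
  "search_select M L F = (SOME J. J \<subseteq> {..<M} \<and> card J = L \<and> (F \<noteq> {} \<longrightarrow> J \<in> F))"

definition fitting_sets :: "complex set \<Rightarrow> nat \<Rightarrow> nat \<Rightarrow> nat \<Rightarrow> real \<Rightarrow> (nat \<times> nat \<Rightarrow> complex) \<Rightarrow> (nat \<Rightarrow> complex) \<Rightarrow> nat set set" where
  "fitting_sets D N M L t A y = {J. J \<subseteq> {..<M} \<and> card J = L \<and> fits D N t A y J}"

text \<open>The error metric sees only the support, so an indicator vector is estimate
  enough.\<close>

definition search_algorithm :: "complex set \<Rightarrow> nat \<Rightarrow> nat \<Rightarrow> nat \<Rightarrow> real \<Rightarrow> algorithm" where
  "search_algorithm D N M L t A y =
     (\<lambda>i\<in>{..<M}. of_bool (i \<in> search_select M L (fitting_sets D N M L t A y)))"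

lemma search_select:
  assumes "L \<le> M" and F: "F \<subseteq> {J. J \<subseteq> {..<M} \<and> card J = L}"
  shows "search_select M L F \<subseteq> {..<M}" and "card (search_select M L F) = L"
    and "F \<noteq> {} \<Longrightarrow> search_select M L F \<in> F"
proof -
  have "\<exists>J. J \<subseteq> {..<M} \<and> card J = L \<and> (F \<noteq> {} \<longrightarrow> J \<in> F)"
  proof (cases "F = {}")
    case True
    show ?thesis using True assms(1) by (intro exI[of _ "{..<L}"]) auto
  qed (use F in auto)
  from someI_ex[OF this] show "search_select M L F \<subseteq> {..<M}" "card (search_select M L F) = L"
    "F \<noteq> {} \<Longrightarrow> search_select M L F \<in> F"
    by (auto simp: search_select_def)
qed

lemma decoder_search_algorithm:
  assumes "L \<le> M"
  shows "decoder M (search_algorithm D N M L t) A y = search_select M L (fitting_sets D N M L t A y)"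
  using search_select(1)[OF assms, of "fitting_sets D N M L t A y"]
  by (auto simp: decoder_def support_def search_algorithm_def fitting_sets_def split: if_splits)

text \<open>The data enter through the family of fitting sets, which takes finitely many values;
  each value is attained on a finite Boolean combination of fitting events. Every map out of this
  discrete space is measurable.\<close>

lemma sparse_recovery_search_algorithm:
  assumes "L \<le> M" and D: "countable D"
  shows "sparse_recovery_algorithm N M L (search_algorithm D N M L t)"
proof -
  let ?\<Omega> = "PiM ({..<N} \<times> {..<M}) (\<lambda>_. borel) \<Otimes>\<^sub>M PiM {..<N} (\<lambda>_. borel)
    :: ((nat \<times> nat \<Rightarrow> complex) \<times> (nat \<Rightarrow> complex)) measure"
  have fits: "Measurable.pred ?\<Omega> (\<lambda>\<omega>. fits D N t (fst \<omega>) (snd \<omega>) J)" if "J \<subseteq> {..<M}" for J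
  proof (rule fits_measurable[OF D])
    show "finite J" using that finite_subset by blast
    show "(\<lambda>\<omega>. fst \<omega> (i, j)) \<in> borel_measurable ?\<Omega>" if "i < N" "j \<in> J" for i j
      using that \<open>J \<subseteq> {..<M}\<close> by (intro measurable_compose[OF measurable_fst measurable_component_singleton]) auto
    show "(\<lambda>\<omega>. snd \<omega> i) \<in> borel_measurable ?\<Omega>" if "i < N" for i
      using that by (intro measurable_compose[OF measurable_snd measurable_component_singleton]) auto
  qed
  have "(\<lambda>\<omega>. fitting_sets D N M L t (fst \<omega>) (snd \<omega>)) \<in> ?\<Omega> \<rightarrow>\<^sub>M count_space (Pow (Pow {..<M}))"
  proof (intro measurable_count_space_eq2[THEN iffD2] conjI ballI funcsetI)
    fix F
    have "Measurable.pred ?\<Omega> (\<lambda>\<omega>. \<forall>J\<in>Pow {..<M}. (card J = L \<and> fits D N t (fst \<omega>) (snd \<omega>) J) = (J \<in> F))"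
      by (intro pred_intros_finite pred_intros_logic fits) auto
    moreover assume "F \<in> Pow (Pow {..<M})"
    then have "(\<lambda>\<omega>. fitting_sets D N M L t (fst \<omega>) (snd \<omega>)) -` {F} \<inter> space ?\<Omega>
      = {\<omega> \<in> space ?\<Omega>. \<forall>J\<in>Pow {..<M}. (card J = L \<and> fits D N t (fst \<omega>) (snd \<omega>) J) = (J \<in> F)}"
      unfolding fitting_sets_def by (intro set_eqI) auto
    ultimately show "(\<lambda>\<omega>. fitting_sets D N M L t (fst \<omega>) (snd \<omega>)) -` {F} \<inter> space ?\<Omega> \<in> sets ?\<Omega>"
      by (simp only: pred_def)
  next
    show "fitting_sets D N M L t (fst \<omega>) (snd \<omega>) \<in> Pow (Pow {..<M})" for \<omega>
      by (auto simp: fitting_sets_def)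
  qed simp
  moreover have "(\<lambda>F. (\<lambda>i\<in>{..<M}. of_bool (i \<in> search_select M L F)))
      \<in> count_space (Pow (Pow {..<M})) \<rightarrow>\<^sub>M PiM {..<M} (\<lambda>_. borel :: complex measure)"
    by (subst measurable_count_space_eq1) (simp add: space_PiM)
  ultimately have "(\<lambda>\<omega>. (\<lambda>i\<in>{..<M}. of_bool (i \<in> search_select M L (fitting_sets D N M L t (fst \<omega>) (snd \<omega>)))))
      \<in> ?\<Omega> \<rightarrow>\<^sub>M PiM {..<M} (\<lambda>_. borel :: complex measure)"
    by (rule measurable_compose)
  moreover have "card (support M (search_algorithm D N M L t A y)) = L" for A y
    using decoder_search_algorithm[OF assms(1), of D N t A y] search_select(2)[OF assms(1), of "fitting_sets D N M L t A y"]
    by (auto simp: decoder_def fitting_sets_def)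
  ultimately show ?thesis
    unfolding sparse_recovery_algorithm_def search_algorithm_def by (simp add: split_beta')
qed

section \<open>Error probability of the search\<close>

lemma sets_gaussian_matrix [measurable_cong]:
  "sets (gaussian_matrix N M) = sets (PiM ({..<N} \<times> {..<M}) (\<lambda>_. borel))"
  unfolding gaussian_matrix_def by (intro sets_PiM_cong) auto

lemma sets_gaussian_noise [measurable_cong]:
  "sets (gaussian_noise \<nu> N) = sets (PiM {..<N} (\<lambda>_. borel))"
  unfolding gaussian_noise_def by (intro sets_PiM_cong) auto

lemma prob_space_gaussian_matrix: "prob_space (gaussian_matrix N M)"
  unfolding gaussian_matrix_def by (intro prob_space_PiM prob_space_complex_normal) simp

lemma prob_space_gaussian_noise: "\<nu> \<noteq> 0 \<Longrightarrow> prob_space (gaussian_noise \<nu> N)"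
  unfolding gaussian_noise_def by (intro prob_space_PiM prob_space_complex_normal) simp

text \<open>Chernoff bound: on the event, the exponential of \<open>\<theta>\<close> times the
  excess energy is at least 1.\<close>

lemma noise_energy_tail:
  assumes \<nu>: "\<nu> \<noteq> 0" and \<theta>: "0 \<le> \<theta>" "\<theta> * \<nu>\<^sup>2 < 1"
  shows "emeasure (gaussian_noise \<nu> N) {n \<in> space (gaussian_noise \<nu> N). t \<le> (\<Sum>i<N. (cmod (n i))\<^sup>2)}
       \<le> ennreal (exp (- \<theta> * t) * (1 / (1 - \<theta> * \<nu>\<^sup>2)) ^ N)"
proof -
  let ?T = "{n \<in> space (gaussian_noise \<nu> N). t \<le> (\<Sum>i<N. (cmod (n i))\<^sup>2)}"
  have "emeasure (gaussian_noise \<nu> N) ?T = (\<integral>\<^sup>+n. indicator ?T n \<partial>gaussian_noise \<nu> N)"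
    by (rule nn_integral_indicator[symmetric]) measurable
  also have "\<dots> \<le> (\<integral>\<^sup>+n. ennreal (exp (- \<theta> * t)) * ennreal (exp (\<theta> * (\<Sum>i<N. (cmod (n i))\<^sup>2))) \<partial>gaussian_noise \<nu> N)"
  proof (rule nn_integral_mono)
    fix n
    show "indicator ?T n \<le> ennreal (exp (- \<theta> * t)) * ennreal (exp (\<theta> * (\<Sum>i<N. (cmod (n i))\<^sup>2)))"
      using \<theta> mult_left_mono[of t "\<Sum>i<N. (cmod (n i))\<^sup>2" \<theta>]
      by (auto simp: indicator_def mult_exp_exp simp flip: ennreal_mult)
  qed
  also have "\<dots> = ennreal (exp (- \<theta> * t)) * ennreal ((1 / (1 - \<theta> * \<nu>\<^sup>2)) ^ N)"
    using nn_integral_exp_energy[of "{..<N}" "\<nu>\<^sup>2" \<theta>] assms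
    by (subst nn_integral_cmult) (simp_all add: gaussian_noise_def)
  finally show ?thesis using \<theta> by (simp flip: ennreal_mult)
qed

lemma fits_observation_measurable:
  assumes "countable D" and "J \<subseteq> {..<M}"
  shows "Measurable.pred (gaussian_matrix N M \<Otimes>\<^sub>M gaussian_noise \<nu> N)
           (\<lambda>\<omega>. fits D N t (fst \<omega>) (observation N M (fst \<omega>) x (snd \<omega>)) J)"
proof (rule fits_measurable[OF assms(1)])
  let ?\<Omega> = "gaussian_matrix N M \<Otimes>\<^sub>M gaussian_noise \<nu> N"
  show "finite J" using assms(2) finite_subset by blast
  have A: "(\<lambda>\<omega>. fst \<omega> (i, j)) \<in> borel_measurable ?\<Omega>" if "i < N" "j < M" for i j
  proof -
    have "(i, j) \<in> {..<N} \<times> {..<M}" using that by simp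
    then show ?thesis by measurable
  qed
  then show "(\<lambda>\<omega>. fst \<omega> (i, j)) \<in> borel_measurable ?\<Omega>" if "i < N" "j \<in> J" for i j
    using that assms(2) by auto
  show "(\<lambda>\<omega>. observation N M (fst \<omega>) x (snd \<omega>) i) \<in> borel_measurable ?\<Omega>" if "i < N" for i
    using that A unfolding observation_def by (simp add: borel_measurable_sum)
qed

text \<open>Fix the columns in \<open>J\<close>. Their contribution to the signal lies in the span
  being searched, so only the missed columns and the noise count, and they are independent of that
  span. A Chernoff bound with \<open>laplace_residual\<close> is uniform in the fixed columns, and
  averaging over those preserves it.\<close>

lemma fits_observation_prob:
  fixes N M :: nat and x :: "nat \<Rightarrow> complex"
  assumes D: "countable D" and J: "J \<subseteq> {..<M}" and \<nu>: "\<nu> \<noteq> 0" and s: "0 \<le> s"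
  defines "\<sigma> \<equiv> \<nu>\<^sup>2 + (\<Sum>j\<in>{..<M} - J. (cmod (x j))\<^sup>2)"
  shows "(\<integral>\<^sup>+A. \<integral>\<^sup>+n. indicator {n. fits D N t A (observation N M A x n) J} n \<partial>gaussian_noise \<nu> N \<partial>gaussian_matrix N M)
       \<le> ennreal (exp (s * t) * ((1 + s * \<sigma>) ^ card J / (1 + s * \<sigma>) ^ N))"
    (is "_ \<le> ennreal ?B")
proof -
  define S where "S = {..<M} - J"
  have fin: "finite J" "finite S" using J finite_subset unfolding S_def by auto
  interpret Z: prob_space "gaussian_noise \<nu> N" by (rule prob_space_gaussian_noise[OF \<nu>])
  interpret XJ: prob_space "PiM ({..<N} \<times> J) (\<lambda>_. complex_normal 1)"
    by (intro prob_space_PiM prob_space_complex_normal) simp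
  interpret product_prob_space "\<lambda>_. complex_normal 1" UNIV
    by (rule product_prob_space_complex_normal) simp
  have split: "{..<N} \<times> {..<M} = {..<N} \<times> J \<union> {..<N} \<times> S" using J by (auto simp: S_def)
  have \<sigma>: "0 < \<sigma>" using \<nu> by (simp add: \<sigma>_def add_pos_nonneg sum_nonneg)
  let ?f = "\<lambda>A. \<integral>\<^sup>+n. indicator {n. fits D N t A (observation N M A x n) J} n \<partial>gaussian_noise \<nu> N"
  have meas: "?f \<in> borel_measurable (gaussian_matrix N M)"
  proof (rule Z.borel_measurable_nn_integral)
    have "(\<lambda>(A, n). indicator {n. fits D N t A (observation N M A x n) J} n :: ennreal)
        = (\<lambda>\<omega>. if fits D N t (fst \<omega>) (observation N M (fst \<omega>) x (snd \<omega>)) J then 1 else 0)"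
      by (auto simp: indicator_def)
    also have "\<dots> \<in> borel_measurable (gaussian_matrix N M \<Otimes>\<^sub>M gaussian_noise \<nu> N)"
      using fits_observation_measurable[OF D J] by (intro measurable_If) (auto simp: pred_def)
    finally show "(\<lambda>(A, n). indicator {n. fits D N t A (observation N M A x n) J} n :: ennreal)
        \<in> borel_measurable (gaussian_matrix N M \<Otimes>\<^sub>M gaussian_noise \<nu> N)" .
  qed
  have block: "(\<integral>\<^sup>+Y. ?f (merge ({..<N} \<times> J) ({..<N} \<times> S) (X, Y)) \<partial>PiM ({..<N} \<times> S) (\<lambda>_. complex_normal 1)) \<le> ennreal ?B" for X
  proof -
    define g where "g Y n i = (\<Sum>j\<in>S. Y (i, j) * x j) + n i" for Y n and i :: nat
    obtain u where u: "semi_orthonormal {..<N} J u"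
      and "\<forall>j\<in>J. \<exists>c. \<forall>i\<in>{..<N}. X (i, j) = (\<Sum>k\<in>J. c k * u k i)"
      using gram_schmidt[of "{..<N}" J "\<lambda>j i. X (i, j)"] fin by blast
    then obtain c where c: "\<And>i j. j \<in> J \<Longrightarrow> i < N \<Longrightarrow> X (i, j) = (\<Sum>k\<in>J. c j k * u k i)"
      by (metis lessThan_iff)
    \<comment> \<open>The squared distance of \<open>g\<close> to the span of the columns in
      \<open>J\<close>.\<close>
    define E where "E Y n = (\<Sum>i<N. (cmod (g Y n i))\<^sup>2) - (\<Sum>k\<in>J. (cmod (\<Sum>i<N. g Y n i * cnj (u k i)))\<^sup>2)" for Y n
    have E_less: "E Y n < t"
      if fit: "fits D N t (merge ({..<N} \<times> J) ({..<N} \<times> S) (X, Y)) (observation N M (merge ({..<N} \<times> J) ({..<N} \<times> S) (X, Y)) x n) J"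
        (is "fits D N t ?A ?y J") for Y n
    proof -
      obtain z where z: "residual N J ?A ?y z < t" using fit by (auto simp: fits_def)
      \<comment> \<open>The true coefficients on \<open>J\<close> are absorbed into the fit: the
        error is \<open>g\<close> minus the columns combined with weights \<open>z - x\<close>, and
        \<open>d\<close> expresses that combination in the family \<open>u\<close>.\<close>
      define d where "d k = (\<Sum>j\<in>J. (z j - x j) * c j k)" for k
      have "?y i - (\<Sum>j\<in>J. ?A (i, j) * z j) = g Y n i - (\<Sum>k\<in>J. d k * u k i)" if i: "i < N" for i
      proof -
        have "(\<Sum>j<M. ?A (i, j) * x j) = (\<Sum>j\<in>J. ?A (i, j) * x j) + (\<Sum>j\<in>S. ?A (i, j) * x j)"
          using sum.subset_diff[OF J, of "\<lambda>j. ?A (i, j) * x j"] by (simp add: S_def)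
        moreover have "(\<Sum>j\<in>S. ?A (i, j) * x j) = (\<Sum>j\<in>S. Y (i, j) * x j)"
          using i by (intro sum.cong) (auto simp: merge_def S_def)
        ultimately have "?y i - (\<Sum>j\<in>J. ?A (i, j) * z j) = g Y n i - (\<Sum>j\<in>J. ?A (i, j) * (z j - x j))"
          using i by (simp add: observation_def g_def right_diff_distrib sum_subtractf)
        also have "(\<Sum>j\<in>J. ?A (i, j) * (z j - x j)) = (\<Sum>j\<in>J. (\<Sum>k\<in>J. c j k * u k i) * (z j - x j))"
          using i c by (intro sum.cong) (auto simp: merge_def)
        also have "\<dots> = (\<Sum>k\<in>J. d k * u k i)"
          unfolding d_def sum_distrib_right by (subst sum.swap) (simp add: mult_ac)
        finally show ?thesis .
      qed
      then have "residual N J ?A ?y z = (\<Sum>i<N. (cmod (g Y n i - (\<Sum>k\<in>J. d k * u k i)))\<^sup>2)"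
        by (simp add: residual_def)
      then show ?thesis
        using z semi_orthonormal_dist[OF _ fin(1) u, of "g Y n" d] by (simp add: E_def)
    qed
    have "(\<integral>\<^sup>+Y. ?f (merge ({..<N} \<times> J) ({..<N} \<times> S) (X, Y)) \<partial>PiM ({..<N} \<times> S) (\<lambda>_. complex_normal 1))
      \<le> (\<integral>\<^sup>+Y. \<integral>\<^sup>+n. ennreal (exp (s * t)) * ennreal (exp (- s * E Y n)) \<partial>gaussian_noise \<nu> N \<partial>PiM ({..<N} \<times> S) (\<lambda>_. complex_normal 1))"
    proof (intro nn_integral_mono)
      fix Y n
      show "indicator {n. fits D N t (merge ({..<N} \<times> J) ({..<N} \<times> S) (X, Y)) (observation N M (merge ({..<N} \<times> J) ({..<N} \<times> S) (X, Y)) x n) J} n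
        \<le> ennreal (exp (s * t)) * ennreal (exp (- s * E Y n))"
        using E_less[of Y n] s mult_left_mono[of "E Y n" t s]
        by (auto simp: indicator_def mult_exp_exp simp flip: ennreal_mult)
    qed
    also have "\<dots> = ennreal (exp (s * t)) * (\<integral>\<^sup>+Y. \<integral>\<^sup>+n. ennreal (exp (- s * E Y n)) \<partial>gaussian_noise \<nu> N \<partial>PiM ({..<N} \<times> S) (\<lambda>_. complex_normal 1))"
    proof -
      have [measurable_cong]: "sets (PiM ({..<N} \<times> S) (\<lambda>_. complex_normal 1)) = sets (PiM ({..<N} \<times> S) (\<lambda>_. borel))"
        by (intro sets_PiM_cong) auto
      have [measurable]: "(\<lambda>\<omega>. E (fst \<omega>) (snd \<omega>)) \<in> borel_measurable (PiM ({..<N} \<times> S) (\<lambda>_. complex_normal 1) \<Otimes>\<^sub>M gaussian_noise \<nu> N)"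
        unfolding E_def g_def by measurable
      have "(\<lambda>n. ennreal (exp (- s * E Y n))) \<in> borel_measurable (gaussian_noise \<nu> N)" for Y
        unfolding E_def g_def by measurable
      moreover have "(\<lambda>Y. \<integral>\<^sup>+n. ennreal (exp (- s * E Y n)) \<partial>gaussian_noise \<nu> N) \<in> borel_measurable (PiM ({..<N} \<times> S) (\<lambda>_. complex_normal 1))"
        by (rule Z.borel_measurable_nn_integral) (simp add: split_beta')
      ultimately show ?thesis by (simp only: nn_integral_cmult)
    qed
    also have "\<dots> \<le> ennreal (exp (s * t)) * ennreal ((1 + s * \<sigma>) ^ card J / (1 + s * \<sigma>) ^ N)"
      unfolding E_def g_def gaussian_noise_def \<sigma>_def S_def[symmetric]
      using fin u \<nu> s by (intro mult_left_mono laplace_residual) auto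
    also have "\<dots> = ennreal ?B" using s \<sigma> by (simp flip: ennreal_mult)
    finally show ?thesis .
  qed
  have "(\<integral>\<^sup>+A. ?f A \<partial>gaussian_matrix N M)
     = (\<integral>\<^sup>+X. \<integral>\<^sup>+Y. ?f (merge ({..<N} \<times> J) ({..<N} \<times> S) (X, Y)) \<partial>PiM ({..<N} \<times> S) (\<lambda>_. complex_normal 1) \<partial>PiM ({..<N} \<times> J) (\<lambda>_. complex_normal 1))"
    unfolding gaussian_matrix_def split
    by (rule product_nn_integral_fold) (use fin meas in \<open>auto simp: S_def gaussian_matrix_def split\<close>)
  also have "\<dots> \<le> (\<integral>\<^sup>+X. ennreal ?B \<partial>PiM ({..<N} \<times> J) (\<lambda>_. complex_normal 1))"
    by (intro nn_integral_mono block)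
  also have "\<dots> = ennreal ?B" by (simp add: XJ.emeasure_space_1)
  finally show ?thesis .
qed

text \<open>A non-integrable function has Bochner integral 0 by convention, so the bound covers it
  too; it can thus be applied to \<open>p_err_fixed\<close> as a function of the matrix.\<close>

lemma integral_le_if_nn_integral_le:
  assumes "\<And>x. 0 \<le> f x" and "0 \<le> B" and "(\<integral>\<^sup>+x. ennreal (f x) \<partial>M) \<le> ennreal B"
  shows "integral\<^sup>L M f \<le> B"
proof (cases "integrable M f")
  case True
  then show ?thesis using assms by (simp add: nn_integral_eq_integral)
qed (use assms in \<open>simp add: not_integrable_integral_eq\<close>)

text \<open>If the noise energy is below \<open>t\<close>, the true support fits, so the selected
  set fits as well. An error therefore requires large noise or a fitting bad set, and a union bound
  over at most \<open>2 ^ M\<close> bad sets follows.\<close>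

lemma p_err_search_algorithm_le:
  fixes N M :: nat and x :: "nat \<Rightarrow> complex"
  assumes D: "countable D" "closure D = UNIV" and \<nu>: "\<nu> \<noteq> 0"
    and \<theta>: "0 \<le> \<theta>" "\<theta> * \<nu>\<^sup>2 < 1" and s: "0 \<le> s" and \<sigma>: "0 \<le> \<sigma>"
    and L: "L = card (support M x)" "L \<le> N"
    and missed: "\<And>J. J \<subseteq> {..<M} \<Longrightarrow> card J = L \<Longrightarrow> \<not> success2 \<alpha> J (support M x) \<Longrightarrow>
        \<sigma> \<le> \<nu>\<^sup>2 + (\<Sum>j\<in>{..<M} - J. (cmod (x j))\<^sup>2)"
  shows "p_err \<alpha> \<nu> N M (search_algorithm D N M L t) x
       \<le> exp (- \<theta> * t) * (1 / (1 - \<theta> * \<nu>\<^sup>2)) ^ N + 2 ^ M * (exp (s * t) * ((1 + s * \<sigma>) ^ L / (1 + s * \<sigma>) ^ N))"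
    (is "_ \<le> ?B1 + 2 ^ M * ?B2")
proof -
  define I where "I = support M x"
  have I: "I \<subseteq> {..<M}" "card I = L" using L by (auto simp: I_def support_def)
  have finI: "finite I" using I(1) finite_subset by blast
  have LM: "L \<le> M" using card_mono[OF _ I(1)] I(2) by simp
  define Bad where "Bad = {J. J \<subseteq> {..<M} \<and> card J = L \<and> \<not> success2 \<alpha> J I}"
  have Bad: "Bad \<subseteq> Pow {..<M}" by (auto simp: Bad_def)
  then have finB: "finite Bad" by (rule finite_subset) simp
  have cardB: "card Bad \<le> 2 ^ M" using card_mono[OF _ Bad] by (simp add: card_Pow)
  let ?Z = "gaussian_noise \<nu> N" and ?X = "gaussian_matrix N M"
  let ?y = "\<lambda>A n. observation N M A x n"
  interpret Z: prob_space ?Z by (rule prob_space_gaussian_noise[OF \<nu>])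
  interpret X: prob_space ?X by (rule prob_space_gaussian_matrix)
  define T where "T = {n \<in> space ?Z. t \<le> (\<Sum>i<N. (cmod (n i))\<^sup>2)}"
  have T: "T \<in> sets ?Z" unfolding T_def by measurable
  define G where "G J A = {n \<in> space ?Z. fits D N t A (?y A n) J}" for J A
  have joint: "Measurable.pred (?X \<Otimes>\<^sub>M ?Z) (\<lambda>\<omega>. fits D N t (fst \<omega>) (?y (fst \<omega>) (snd \<omega>)) J)" if "J \<subseteq> {..<M}" for J
    by (rule fits_observation_measurable[OF D(1) that])
  have G: "G J A \<in> sets ?Z" if "J \<subseteq> {..<M}" "A \<in> space ?X" for J A
  proof -
    have "Measurable.pred ?Z (\<lambda>n. fits D N t (fst (A, n)) (?y (fst (A, n)) (snd (A, n))) J)"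
      by (rule measurable_compose[OF measurable_Pair1'[OF that(2)] joint[OF that(1)]])
    then show ?thesis by (simp add: G_def pred_def)
  qed
  have Gm: "(\<lambda>A. emeasure ?Z (G J A)) \<in> borel_measurable ?X" if "J \<subseteq> {..<M}" for J
  proof (rule Z.measurable_emeasure)
    show "G J A \<subseteq> space ?Z" for A by (auto simp: G_def)
    have "{\<omega> \<in> space (?X \<Otimes>\<^sub>M ?Z). snd \<omega> \<in> G J (fst \<omega>)}
       = {\<omega> \<in> space (?X \<Otimes>\<^sub>M ?Z). fits D N t (fst \<omega>) (?y (fst \<omega>) (snd \<omega>)) J}"
      by (auto simp: G_def space_pair_measure)
    then show "{\<omega> \<in> space (?X \<Otimes>\<^sub>M ?Z). snd \<omega> \<in> G J (fst \<omega>)} \<in> sets (?X \<Otimes>\<^sub>M ?Z)"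
      using joint[OF that] by (simp add: pred_def)
  qed
  have err: "ennreal (p_err_fixed \<alpha> \<nu> N M (search_algorithm D N M L t) x A)
      \<le> emeasure ?Z T + (\<Sum>J\<in>Bad. emeasure ?Z (G J A))" if A: "A \<in> space ?X" for A
  proof -
    let ?E = "{n \<in> space ?Z. \<not> success2 \<alpha> (decoder M (search_algorithm D N M L t) A (?y A n)) (support M x)}"
    have GA: "(\<Union>J\<in>Bad. G J A) \<in> sets ?Z" using G Bad A finB by (intro sets.finite_UN) auto
    have "?E \<subseteq> T \<union> (\<Union>J\<in>Bad. G J A)"
    proof
      fix n assume n: "n \<in> ?E"
      let ?F = "fitting_sets D N M L t A (?y A n)"
      define J where "J = search_select M L ?F"
      have F: "?F \<subseteq> {J. J \<subseteq> {..<M} \<and> card J = L}" by (auto simp: fitting_sets_def)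
      have "J \<in> Bad"
        using n search_select[OF LM F] unfolding J_def Bad_def I_def by (simp add: decoder_search_algorithm[OF LM])
      show "n \<in> T \<union> (\<Union>J\<in>Bad. G J A)"
      proof (cases "n \<in> T")
        case False
        \<comment> \<open>The signal itself serves as coefficient vector on \<open>I\<close>; its
          residual is exactly the noise energy.\<close>
        have "(\<Sum>j<M. A (i, j) * x j) = (\<Sum>j\<in>I. A (i, j) * x j)" for i
          using I(1) by (intro sum.mono_neutral_right) (auto simp: I_def support_def)
        then have "residual N I A (?y A n) x = (\<Sum>i<N. (cmod (n i))\<^sup>2)"
          by (simp add: residual_def observation_def)
        then have "residual N I A (?y A n) x < t" using False n by (simp add: T_def)
        then have "fits D N t A (?y A n) I" by (rule fits_if_residual_less[OF D(2) finI])
        then have "?F \<noteq> {}" using I by (auto simp: fitting_sets_def)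
        then have "J \<in> ?F" unfolding J_def by (rule search_select(3)[OF LM F])
        then have "n \<in> G J A" using n by (simp add: G_def fitting_sets_def)
        with \<open>J \<in> Bad\<close> show ?thesis by blast
      qed simp
    qed
    then have "emeasure ?Z ?E \<le> emeasure ?Z (T \<union> (\<Union>J\<in>Bad. G J A))"
      by (rule emeasure_mono) (use T GA in auto)
    also have "\<dots> \<le> emeasure ?Z T + emeasure ?Z (\<Union>J\<in>Bad. G J A)"
      by (rule emeasure_subadditive[OF T GA])
    also have "emeasure ?Z (\<Union>J\<in>Bad. G J A) \<le> (\<Sum>J\<in>Bad. emeasure ?Z (G J A))"
      using G Bad A finB by (intro emeasure_subadditive_finite) auto
    finally show ?thesis by (simp add: p_err_fixed_def Z.emeasure_eq_measure add_left_mono)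
  qed
  have GB: "(\<integral>\<^sup>+A. emeasure ?Z (G J A) \<partial>?X) \<le> ennreal ?B2" if J: "J \<in> Bad" for J
  proof -
    have JM: "J \<subseteq> {..<M}" and Jb: "\<sigma> \<le> \<nu>\<^sup>2 + (\<Sum>j\<in>{..<M} - J. (cmod (x j))\<^sup>2)" and Jc: "card J = L"
      using J missed by (auto simp: Bad_def I_def)
    let ?\<sigma> = "\<nu>\<^sup>2 + (\<Sum>j\<in>{..<M} - J. (cmod (x j))\<^sup>2)"
    have ind: "emeasure ?Z (G J A) = (\<integral>\<^sup>+n. indicator {n. fits D N t A (?y A n) J} n \<partial>?Z)" if "A \<in> space ?X" for A
      unfolding nn_integral_indicator[OF G[OF JM that], symmetric]
      by (intro nn_integral_cong) (auto simp: G_def indicator_def)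
    \<comment> \<open>With \<open>L \<le> N\<close> the quotient is visibly decreasing in the
      variance, so the common lower bound \<open>\<sigma>\<close> serves all bad sets.\<close>
    have decay: "(1 + s * \<tau>) ^ L / (1 + s * \<tau>) ^ N = 1 / (1 + s * \<tau>) ^ (N - L)" if "0 \<le> \<tau>" for \<tau>
    proof -
      have "1 + s * \<tau> \<noteq> 0" using s that by (simp add: add_nonneg_eq_0_iff)
      then show ?thesis using L(2) by (simp add: power_diff)
    qed
    have "(\<integral>\<^sup>+A. emeasure ?Z (G J A) \<partial>?X) = (\<integral>\<^sup>+A. \<integral>\<^sup>+n. indicator {n. fits D N t A (?y A n) J} n \<partial>?Z \<partial>?X)"
      by (intro nn_integral_cong ind)
    also have "\<dots> \<le> ennreal (exp (s * t) * ((1 + s * ?\<sigma>) ^ card J / (1 + s * ?\<sigma>) ^ N))"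
      by (rule fits_observation_prob[OF D(1) JM \<nu> s])
    also have "\<dots> \<le> ennreal ?B2"
    proof (intro ennreal_leI mult_left_mono)
      have "(1 + s * \<sigma>) ^ (N - L) \<le> (1 + s * ?\<sigma>) ^ (N - L)"
        using Jb s \<sigma> by (intro power_mono add_left_mono mult_left_mono) auto
      moreover have "0 < (1 + s * \<sigma>) ^ (N - L)" using s \<sigma> by (intro zero_less_power add_pos_nonneg) auto
      ultimately show "(1 + s * ?\<sigma>) ^ card J / (1 + s * ?\<sigma>) ^ N \<le> (1 + s * \<sigma>) ^ L / (1 + s * \<sigma>) ^ N"
        using \<sigma> Jb by (simp add: Jc decay frac_le)
    qed simp
    finally show ?thesis .
  qed
  have B1: "0 \<le> ?B1" using \<theta> by simp
  have B2: "0 \<le> ?B2" using s \<sigma> by simp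
  have "(\<integral>\<^sup>+A. ennreal (p_err_fixed \<alpha> \<nu> N M (search_algorithm D N M L t) x A) \<partial>?X)
     \<le> (\<integral>\<^sup>+A. emeasure ?Z T + (\<Sum>J\<in>Bad. emeasure ?Z (G J A)) \<partial>?X)"
    by (intro nn_integral_mono err)
  also have "\<dots> = emeasure ?Z T + (\<Sum>J\<in>Bad. \<integral>\<^sup>+A. emeasure ?Z (G J A) \<partial>?X)"
    using Gm Bad by (subst nn_integral_add) (auto simp: nn_integral_sum X.emeasure_space_1 intro!: borel_measurable_sum nn_integral_sum)
  also have "\<dots> \<le> ennreal ?B1 + (\<Sum>J\<in>Bad. ennreal ?B2)"
    unfolding T_def by (intro add_mono sum_mono GB noise_energy_tail \<nu> \<theta>)
  also have "\<dots> = ennreal (?B1 + card Bad * ?B2)"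
  proof -
    have "ennreal b + of_nat m * ennreal c = ennreal (b + real m * c)" if "0 \<le> b" "0 \<le> c" for b c :: real and m
      using that by (simp add: ennreal_of_nat_eq_real_of_nat flip: ennreal_mult ennreal_plus)
    from this[OF B1 B2] show ?thesis by (simp only: sum_constant)
  qed
  also have "\<dots> \<le> ennreal (?B1 + 2 ^ M * ?B2)"
    using B2 cardB by (intro ennreal_leI add_left_mono mult_right_mono) (simp_all add: numeral_power_le_of_nat_cancel_iff of_nat_le_numeral_power_cancel_iff)
  finally show ?thesis
    unfolding p_err_def
  proof (rule integral_le_if_nn_integral_le[rotated 2])
    show "0 \<le> ?B1 + 2 ^ M * ?B2" by (rule add_nonneg_nonneg[OF B1 mult_nonneg_nonneg[OF _ B2]]) simp
  qed (simp add: p_err_fixed_def)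
qed

section \<open>Asymptotics\<close>

lemma min_abs_pos_le:
  assumes "card (support M x) \<ge> 1"
  shows "0 < min_abs M x" and "i \<in> support M x \<Longrightarrow> min_abs M x \<le> cmod (x i)"
proof -
  have fin: "finite (support M x)" by (simp add: support_def)
  have ne: "support M x \<noteq> {}" using assms by (intro notI) simp
  with fin show "0 < min_abs M x" by (auto simp: min_abs_def support_def)
  show "i \<in> support M x \<Longrightarrow> min_abs M x \<le> cmod (x i)" using fin by (auto simp: min_abs_def)
qed

text \<open>Success is a strict inequality, so failure leaves at least \<alpha> L support indices
  outside \<open>J\<close>, each carrying energy at least the square of
  \<open>min_abs M x\<close>.\<close>

lemma missed_energy:
  assumes L: "card (support M x) = L" "L \<ge> 1" and fail: "\<not> success2 \<alpha> J (support M x)"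
  shows "\<alpha> * (real L * (min_abs M x)\<^sup>2) \<le> (\<Sum>j\<in>{..<M} - J. (cmod (x j))\<^sup>2)"
proof -
  define I where "I = support M x"
  have fin: "finite I" by (simp add: I_def support_def)
  have "real (card (J \<inter> I)) \<le> (1 - \<alpha>) * real L"
    using fail L by (simp add: success2_def I_def[symmetric] field_simps)
  moreover have "card (J \<inter> I) + card (I - J) = L"
    using card_Int_Diff[OF fin, of J] L by (simp add: I_def Int_commute)
  then have "real (card (J \<inter> I)) + real (card (I - J)) = real L" by linarith
  ultimately have "\<alpha> * real L \<le> real (card (I - J))" by (simp add: algebra_simps)
  then have "\<alpha> * real L * (min_abs M x)\<^sup>2 \<le> real (card (I - J)) * (min_abs M x)\<^sup>2"
    by (rule mult_right_mono) simp
  also have "\<dots> = (\<Sum>j\<in>I - J. (min_abs M x)\<^sup>2)" by simp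
  also have "\<dots> \<le> (\<Sum>j\<in>I - J. (cmod (x j))\<^sup>2)"
    using min_abs_pos_le[of M x] L by (intro sum_mono power_mono) (auto simp: I_def)
  also have "\<dots> \<le> (\<Sum>j\<in>{..<M} - J. (cmod (x j))\<^sup>2)"
    by (intro sum_mono2) (auto simp: I_def support_def)
  finally show ?thesis by (simp add: mult.assoc)
qed

section \<open>Growth of the sparsity and of the number of measurements\<close>

lemma sparsity_bounds:
  assumes "\<beta> > 1"
  shows "sparsity \<beta> M \<le> M" and "real M \<le> \<beta> * (real (sparsity \<beta> M) + 1)"
proof -
  have s: "real (sparsity \<beta> M) = of_int \<lfloor>1 / \<beta> * real M\<rfloor>"
    using assms by (simp add: sparsity_def)
  have "1 / \<beta> * real M \<le> 1 * real M" using assms by (intro mult_right_mono) auto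
  then have "real (sparsity \<beta> M) \<le> real M" unfolding s by linarith
  then show "sparsity \<beta> M \<le> M" by simp
  have "real M / \<beta> \<le> real (sparsity \<beta> M) + 1" using s by simp
  then show "real M \<le> \<beta> * (real (sparsity \<beta> M) + 1)" using assms by (simp add: field_simps)
qed

lemma sparsity_at_top:
  assumes "\<beta> > 1" shows "filterlim (\<lambda>M. real (sparsity \<beta> M)) at_top sequentially"
proof (rule filterlim_at_top_mono)
  show "filterlim (\<lambda>M. real M / \<beta> - 1) at_top sequentially" using assms by real_asymp
  show "eventually (\<lambda>M. real M / \<beta> - 1 \<le> real (sparsity \<beta> M)) sequentially"
    using sparsity_bounds(2)[OF assms] assms by (intro always_eventually allI) (simp add: field_simps)
qed

lemma sparsity_ge_1_ex:
  assumes "\<beta> > 1" shows "\<exists>M. sparsity \<beta> M \<ge> 1"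
proof -
  have "eventually (\<lambda>M. real (sparsity \<beta> M) \<ge> 1) sequentially"
    using sparsity_at_top[OF assms] unfolding filterlim_at_top by blast
  then show ?thesis by (auto simp: eventually_sequentially)
qed

lemma signal_sequences_pos:
  assumes "\<beta> > 1" and x: "x \<in> signal_sequences \<beta> \<kappa>" shows "\<kappa> > 0"
proof -
  obtain M where M: "sparsity \<beta> M \<ge> 1" using sparsity_ge_1_ex[OF assms(1)] by blast
  then have "card (support M (x M)) \<ge> 1" "real (sparsity \<beta> M) * (min_abs M (x M))\<^sup>2 = \<kappa>"
    using x by (auto simp: signal_sequences_def)
  then show ?thesis using min_abs_pos_le(1)[of M "x M"] M by (auto intro!: mult_pos_pos)
qed

text \<open>The degenerate alternative of \<open>dominates\<close>, both functions zero, is excluded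
  because the sparsity is positive somewhere.\<close>

lemma dominates_sparsity_eventually:
  assumes "\<beta> > 1" "C > 0" and "(\<lambda>M. real (N M)) \<succ> (\<lambda>M. C * real (sparsity \<beta> M))"
  shows "eventually (\<lambda>M. C * real (sparsity \<beta> M) < real (N M)) sequentially"
proof -
  obtain M where "sparsity \<beta> M \<ge> 1" using sparsity_ge_1_ex[OF assms(1)] by blast
  then have "C * real (sparsity \<beta> M) \<noteq> 0" using assms(2) by simp
  then obtain m0 where m0: "\<And>M. M > m0 \<Longrightarrow> 1 < real (N M) / (C * real (sparsity \<beta> M))"
    using assms(3) unfolding dominates_def by blast
  have "C * real (sparsity \<beta> M) < real (N M)" if "M > m0" for M
  proof -
    \<comment> \<open>Division by zero gives 0, so a ratio above 1 forces a nonzero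
      denominator.\<close>
    have "sparsity \<beta> M \<noteq> 0" using m0[OF that] by (intro notI) simp
    then have "0 < C * real (sparsity \<beta> M)" using assms(2) by simp
    then show ?thesis using m0[OF that] by (simp add: less_divide_eq)
  qed
  then show ?thesis by (meson eventually_sequentially less_le_trans lessI)
qed

text \<open>The threshold lies halfway between the noise level \<open>v\<close> and the level \<open>v + h\<close> of a bad support;
  both Laplace exponents below are then positive for small arguments.\<close>

lemma threshold_exponents:
  fixes v h :: real
  assumes v: "v > 0" and h: "h > 0"
  obtains s \<theta> where "s > 0" "s * (v + h / 2) < ln (1 + s * (v + h))"
    "\<theta> > 0" "\<theta> * v < 1" "0 < \<theta> * (v + h / 2) + ln (1 - \<theta> * v)"
proof -
  define \<sigma> where "\<sigma> = v + h"
  have \<sigma>: "\<sigma> > 0" "v \<le> \<sigma>" "h \<le> \<sigma>" using v h by (auto simp: \<sigma>_def)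
  \<comment> \<open>Chosen so that \<open>s * \<sigma>\<^sup>2 = h / 4\<close> is half of the gap
    \<open>h / 2\<close>: the quadratic errors in ln (1 + x) \<ge> x - x^2 and ln (1 - x) \<ge> - x
    - 2 x^2 then use up at most half of the linear gain. The factor 2 in the second estimate is the
    reason for \<open>\<theta> = s / 2\<close>.\<close>
  define s where "s = h / (4 * \<sigma>\<^sup>2)"
  define \<theta> where "\<theta> = s / 2"
  have s: "s > 0" using h \<sigma> by (simp add: s_def)
  have s\<sigma>: "s * \<sigma>\<^sup>2 = h / 4" using \<sigma> by (simp add: s_def)
  have "s * \<sigma> = h / (4 * \<sigma>)" using \<sigma> by (simp add: s_def power2_eq_square)
  also have "\<dots> \<le> 1 / 4" using \<sigma> by (simp add: field_simps)
  finally have s\<sigma>1: "s * \<sigma> \<le> 1 / 4" .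
  have "s * v \<le> s * \<sigma>" using s \<sigma> by simp
  then have sv: "s * v \<le> 1 / 4" using s\<sigma>1 by linarith
  have "s * \<sigma> - (s * \<sigma>)\<^sup>2 \<le> ln (1 + s * \<sigma>)"
    using s \<sigma> s\<sigma>1 by (intro ln_one_plus_pos_lower_bound) auto
  moreover have "s * \<sigma> - (s * \<sigma>)\<^sup>2 = s * (v + h / 2) + s * (h / 2 - s * \<sigma>\<^sup>2)"
    by (simp add: \<sigma>_def power2_eq_square algebra_simps)
  moreover have "0 < s * (h / 2 - s * \<sigma>\<^sup>2)" unfolding s\<sigma> using s h by simp
  ultimately have 1: "s * (v + h / 2) < ln (1 + s * \<sigma>)" by linarith
  have "- (\<theta> * v) - 2 * (\<theta> * v)\<^sup>2 \<le> ln (1 - \<theta> * v)"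
    using s v s\<sigma>1 sv by (intro ln_one_minus_pos_lower_bound) (auto simp: \<theta>_def)
  moreover have "\<theta> * (v + h / 2) - \<theta> * v - 2 * (\<theta> * v)\<^sup>2 = \<theta> * (h / 2 - s * v\<^sup>2)"
    by (simp add: \<theta>_def power2_eq_square algebra_simps)
  moreover have "s * v\<^sup>2 \<le> s * \<sigma>\<^sup>2" using s v \<sigma> by simp
  then have "0 < \<theta> * (h / 2 - s * v\<^sup>2)" unfolding s\<sigma> using s h by (intro mult_pos_pos) (auto simp: \<theta>_def)
  ultimately have 2: "0 < \<theta> * (v + h / 2) + ln (1 - \<theta> * v)" by linarith
  show thesis
    by (rule that[of s \<theta>]) (use s 1 2 s\<sigma>1 sv in \<open>auto simp: \<theta>_def \<sigma>_def\<close>)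
qed

text \<open>The constant is chosen before \<open>N\<close> and before the signals, so it depends on
  the four parameters alone; \<mu> enters through the fixed value \<open>\<kappa>\<close> of L
  \<mu>^2.\<close>

theorem mainTheorem3:
  fixes \<alpha> \<beta> \<nu> \<kappa> :: real
  assumes "0 < \<alpha>" and "\<alpha> < 1" and "\<beta> > 2" and "\<nu> > 0"
  shows "\<exists>C3>1. \<forall>N :: nat \<Rightarrow> nat.
           (\<lambda>M. real (N M)) \<succ> (\<lambda>M. C3 * real (sparsity \<beta> M)) \<longrightarrow>
           recovery_possible \<alpha> \<nu> N (sparsity \<beta>) (signal_sequences \<beta> \<kappa>)"
proof -
  have \<beta>: "\<beta> > 1" using assms by simp
  obtain D :: "complex set" where D: "countable D" "closure D = UNIV"
  proof -
    obtain D :: "complex set" where D: "countable D" "\<And>X. open X \<Longrightarrow> X \<noteq> {} \<Longrightarrow> \<exists>d\<in>D. d \<in> X"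
      by (rule countable_dense_setE) blast
    have "D \<inter> A \<noteq> {}" if "S \<subseteq> A" "open S" "x \<in> S" for x :: complex and A S
      using D(2)[of S] that by blast
    then have "closure D = UNIV" by (simp add: set_eq_iff closure_iff_nhds_not_empty)
    with D(1) show thesis by (rule that)
  qed
  note algorithm = sparse_recovery_search_algorithm[OF sparsity_bounds(1)[OF \<beta>] D(1)]
  show ?thesis
  proof (cases "\<kappa> > 0")
    case False
    \<comment> \<open>Nonzero entries force \<mu> > 0 and hence \<kappa> > 0. Here the class is
      empty, any valid family of algorithms will do, and the constant 2 is arbitrary.\<close>
    then have "signal_sequences \<beta> \<kappa> = {}" using signal_sequences_pos[OF \<beta>] by auto
    then have "recovery_possible \<alpha> \<nu> N (sparsity \<beta>) (signal_sequences \<beta> \<kappa>)" for N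
      unfolding recovery_possible_def using algorithm
      by (intro exI[of _ "\<lambda>M. search_algorithm D (N M) M (sparsity \<beta> M) 0"]) auto
    then show ?thesis by (intro exI[of _ 2]) auto
  next
    case True
    define v where "v = \<nu>\<^sup>2"
    define h where "h = \<alpha> * \<kappa>"
    define \<tau> where "\<tau> = v + h / 2"
    define \<sigma> where "\<sigma> = v + h"
    have v: "v > 0" and h: "h > 0" using assms True by (auto simp: v_def h_def)
    then have \<sigma>: "\<sigma> > 0" by (simp add: \<sigma>_def)
    obtain s \<theta> where s: "s > 0" and \<rho>: "s * \<tau> < ln (1 + s * \<sigma>)"
      and \<theta>: "\<theta> > 0" "\<theta> * v < 1" and a: "0 < \<theta> * \<tau> + ln (1 - \<theta> * v)"
      using threshold_exponents[OF v h] unfolding \<tau>_def \<sigma>_def by metis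
    \<comment> \<open>\<open>\<rho>\<close> and \<open>a\<close> are the decay rates per measurement
      of the two error events: a given bad support fits, and the noise is large.\<close>
    define \<rho> where "\<rho> = ln (1 + s * \<sigma>) - s * \<tau>"
    define a where "a = \<theta> * \<tau> + ln (1 - \<theta> * v)"
    \<comment> \<open>Costs per unit of \<open>L\<close>: \<open>\<beta> * ln 2\<close> for the
      number of candidates, \<open>ln (1 + s * \<sigma>)\<close> for each projected dimension, and 1
      as the decay that remains. The 1 in \<open>C\<close> secures \<open>C > 1\<close> and thereby
      \<open>L \<le> N\<close>.\<close>
    define K where "K = \<beta> * ln 2 + ln (1 + s * \<sigma>) + 1"
    define C where "C = 1 + K / \<rho>"
    have \<rho>0: "\<rho> > 0" and a0: "a > 0" using \<rho> a by (auto simp: \<rho>_def a_def)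
    have s\<sigma>: "1 + s * \<sigma> > 1" using s \<sigma> by simp
    have K: "K > 0" using \<beta> s\<sigma> by (simp add: K_def add_pos_pos)
    have C: "C > 1" using K \<rho>0 by (simp add: C_def)
    have C\<rho>: "K \<le> C * \<rho>" using \<rho>0 by (simp add: C_def field_simps)
    have "recovery_possible \<alpha> \<nu> N (sparsity \<beta>) (signal_sequences \<beta> \<kappa>)"
      if dom: "(\<lambda>M. real (N M)) \<succ> (\<lambda>M. C * real (sparsity \<beta> M))" for N :: "nat \<Rightarrow> nat"
    proof -
      \<comment> \<open>The threshold uses \<alpha>, \<nu>, \<kappa> and \<open>N\<close>, never the
        signal, so one family serves the whole class.\<close>
      define est where "est M = search_algorithm D (N M) M (sparsity \<beta> M) (\<tau> * real (N M))" for M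
      have "asymptotic_reliable_recovery \<alpha> \<nu> N est x" if x: "x \<in> signal_sequences \<beta> \<kappa>" for x
      proof -
        have ev: "eventually (\<lambda>M. C * real (sparsity \<beta> M) < real (N M)) sequentially"
          using dominates_sparsity_eventually[OF \<beta> _ dom] C by simp
        have ev1: "eventually (\<lambda>M. real (sparsity \<beta> M) \<ge> 1) sequentially"
          using sparsity_at_top[OF \<beta>] unfolding filterlim_at_top by blast
        have bound: "p_err \<alpha> \<nu> (N M) M (est M) (x M)
            \<le> exp (- a * real (sparsity \<beta> M)) + exp (\<beta> * ln 2 - real (sparsity \<beta> M))"
          if NM: "C * real (sparsity \<beta> M) < real (N M)" and LM: "real (sparsity \<beta> M) \<ge> 1" for M
        proof -
          define L where "L = sparsity \<beta> M"
          have L1: "L \<ge> 1" and CL: "C * real L < real (N M)" using NM LM by (auto simp: L_def)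
          have "1 * real L \<le> C * real L" using C by (intro mult_right_mono) auto
          then have LN: "L \<le> N M" using CL by simp
          have card: "card (support M (x M)) = L" and \<kappa>: "real L * (min_abs M (x M))\<^sup>2 = \<kappa>"
            using x L1 by (auto simp: signal_sequences_def L_def)
          have "p_err \<alpha> \<nu> (N M) M (est M) (x M)
            \<le> exp (- \<theta> * (\<tau> * real (N M))) * (1 / (1 - \<theta> * \<nu>\<^sup>2)) ^ N M
              + 2 ^ M * (exp (s * (\<tau> * real (N M))) * ((1 + s * \<sigma>) ^ L / (1 + s * \<sigma>) ^ N M))"
            unfolding est_def L_def[symmetric]
          proof (rule p_err_search_algorithm_le[OF D])
            show "\<sigma> \<le> \<nu>\<^sup>2 + (\<Sum>j\<in>{..<M} - J. (cmod (x M j))\<^sup>2)" if "\<not> success2 \<alpha> J (support M (x M))" for J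
              using missed_energy[OF card L1 that] by (simp add: \<kappa> \<sigma>_def v_def h_def)
          qed (use assms s \<sigma> \<theta> LN card in \<open>auto simp: v_def\<close>)
          also have "exp (- \<theta> * (\<tau> * real (N M))) * (1 / (1 - \<theta> * \<nu>\<^sup>2)) ^ N M = exp (- a * real (N M))"
          proof -
            have "1 / (1 - \<theta> * v) = exp (- ln (1 - \<theta> * v))" using \<theta> by (simp add: exp_minus divide_inverse)
            then show ?thesis
              unfolding v_def[symmetric] by (simp add: mult_exp_exp a_def algebra_simps flip: exp_of_nat_mult)
          qed
          also have "exp (- a * real (N M)) \<le> exp (- a * real L)" using a0 LN by simp
          also have "2 ^ M * (exp (s * (\<tau> * real (N M))) * ((1 + s * \<sigma>) ^ L / (1 + s * \<sigma>) ^ N M))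
             = exp (real M * ln 2 + real L * ln (1 + s * \<sigma>) - \<rho> * real (N M))"
          proof -
            have "(2::real) ^ M = exp (real M * ln 2)" by (simp add: exp_of_nat_mult)
            moreover have "(1 + s * \<sigma>) ^ n = exp (real n * ln (1 + s * \<sigma>))" for n
              using s\<sigma> by (simp add: exp_of_nat_mult)
            ultimately show ?thesis
              by (simp add: \<rho>_def algebra_simps flip: exp_add exp_diff)
          qed
          \<comment> \<open>The floor in the sparsity gives M \<le> \<beta> (L + 1), whose extra 1
            leaves the constant \<open>\<beta> * ln 2\<close>. All other costs are covered by \<rho>
            N \<ge> \<rho> C L \<ge> K L.\<close>
          also have "\<dots> \<le> exp (\<beta> * ln 2 - real L)"
          proof -
            have "real M * ln 2 \<le> \<beta> * (real L + 1) * ln 2"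
              using sparsity_bounds(2)[OF \<beta>, of M] by (intro mult_right_mono) (auto simp: L_def)
            moreover have "K * real L \<le> C * \<rho> * real L" using C\<rho> by (intro mult_right_mono) auto
            moreover have "\<rho> * (C * real L) \<le> \<rho> * real (N M)" using CL \<rho>0 by (intro mult_left_mono) auto
            ultimately show ?thesis by (simp add: K_def algebra_simps)
          qed
          finally show ?thesis by (simp add: L_def)
        qed
        have "((\<lambda>y. exp (- a * y)) \<longlongrightarrow> 0) at_top" using a0 by real_asymp
        moreover have "((\<lambda>y. exp (\<beta> * ln 2 - y)) \<longlongrightarrow> 0) at_top" by real_asymp
        ultimately have lim: "((\<lambda>y. exp (- a * y) + exp (\<beta> * ln 2 - y)) \<longlongrightarrow> 0) at_top"
          by (rule tendsto_add_zero)
        have nonneg: "0 \<le> p_err \<alpha> \<nu> (N M) M (est M) (x M)" for M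
          by (simp add: p_err_def p_err_fixed_def)
        show ?thesis
          unfolding asymptotic_reliable_recovery_def
        proof (rule tendsto_sandwich[where f = "\<lambda>_. 0"])
          show "(\<lambda>M. exp (- a * real (sparsity \<beta> M)) + exp (\<beta> * ln 2 - real (sparsity \<beta> M))) \<longlonglongrightarrow> 0"
            by (rule filterlim_compose[OF lim sparsity_at_top[OF \<beta>]])
          show "eventually (\<lambda>M. p_err \<alpha> \<nu> (N M) M (est M) (x M)
            \<le> exp (- a * real (sparsity \<beta> M)) + exp (\<beta> * ln 2 - real (sparsity \<beta> M))) sequentially"
            using ev ev1 by eventually_elim (rule bound)
        qed (use nonneg in auto)
      qed
      then show ?thesis
        unfolding recovery_possible_def using algorithm by (intro exI[of _ est]) (auto simp: est_def)
    qed
    then show ?thesis using C by blast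
  qed
qed

end
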